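(* Let $X$ and $Y$ be real Banach spaces, $\mathscr F_{X,Y}=\mathcal F(X)\widehat\otimes_\pi\mathcal F(Y)$, $Q=\beta_X\widehat\otimes_\pi\beta_Y\colon\mathscr F_{X,Y}\to X\widehat\otimes_\pi Y$, and $$\mathcal Z_{X,Y}=\overline{\operatorname{span}}\{\Sigma_{(a,b)}u-u:(a,b)\in X\times Y,\ u\in\mathscr F_{X,Y}\}$$ (closure in the projective tensor norm), where $\Sigma_{(a,b)}=S_a\widehat\otimes_\pi R_b$. Then $$\mathcal Z_{X,Y}=\ker Q.$$ Moreover, $Q$ induces a surjective linear isometry $\widetilde Q\colon\mathscr F_{X,Y}/\mathcal Z_{X,Y}\to X\widehat\otimes_\pi Y$, determined by $\widetilde Q(\delta_x\otimes\delta_y+\mathcal Z_{X,Y})=x\otimes y$ for $x\in X$, $y\in Y$.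
   Context: For a real Banach space $X$, $\operatorname{Lip}_0(X)$ is the Banach space of Lipschitz functions $f\colon X\to\mathbb R$ with $f(0)=0$, normed by the least Lipschitz constant; $\delta_x\in\operatorname{Lip}_0(X)^*$ is evaluation at $x$, and $\mathcal F(X)=\overline{\operatorname{span}}\{\delta_x:x\in X\}\subseteq\operatorname{Lip}_0(X)^*$ is the Lipschitz-free space. The barycentre map $\beta_X\colon\mathcal F(X)\to X$ is the unique bounded linear operator with $\beta_X(\delta_x)=x$ for all $x$; similarly $\beta_Y$. For $a\in X$, $b\in Y$, $S_a\colon\mathcal F(X)\to\mathcal F(X)$ and $R_b\colon\mathcal F(Y)\to\mathcal F(Y)$ are the unique bounded linear operators (surjective linear isometries) with $S_a\delta_x=\delta_{x+a}-\delta_a$ and $R_b\delta_y=\delta_{y+b}-\delta_b$. $\widehat\otimes_\pi$ is the completed projective tensor product, and for operators $A,B$, $A\widehat\otimes_\pi B$ is the induced bounded operator with $u\otimes v\mapsto Au\otimes Bv$. *)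

theory Defs
  imports "HOL-Analysis.Analysis" "HOL-Library.Poly_Mapping"
begin

section \<open>Norming functionals\<close>

text \<open>
  A case of the Hahn--Banach theorem, needed for \<open>norm_to_completion\<close> and for the definiteness
  of the projective norm.
\<close>

definition sublinear :: "('a::real_vector \<Rightarrow> real) \<Rightarrow> bool" where
  "sublinear q \<longleftrightarrow>
     (\<forall>x y. q (x + y) \<le> q x + q y) \<and> (\<forall>c x. 0 < c \<longrightarrow> q (c *\<^sub>R x) = c * q x)"

lemma sublinear_zero:
  assumes "sublinear q"
  shows "q 0 = 0"
proof -
  have "q (2 *\<^sub>R 0) = 2 * q 0"
    using assms unfolding sublinear_def by (simp del: scaleR_zero_right)
  then show ?thesis by simp
qed

lemma sublinear_minus:
  assumes "sublinear q"
  shows "- q (- x) \<le> q x"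
proof -
  have "q (x + - x) \<le> q x + q (- x)"
    using assms unfolding sublinear_def by blast
  then show ?thesis using sublinear_zero[OF assms] by simp
qed

lemma sublinear_shift:
  fixes q :: "'a::real_vector \<Rightarrow> real"
  assumes q: "sublinear q"
  obtains q' where "sublinear q'" "\<And>x. q' x \<le> q x" "\<And>x. q' x \<le> q (x + y) - q y"
proof -
  define q' where "q' = (\<lambda>x. INF t\<in>{0..}. q (x + t *\<^sub>R y) - t * q y)"
  have add: "q (u + v) \<le> q u + q v" for u v using q by (auto simp: sublinear_def)
  have scale: "q (c *\<^sub>R u) = c * q u" if "0 < c" for c u using q that by (auto simp: sublinear_def)
  have zero: "q 0 = 0" by (rule sublinear_zero[OF q])
  have scale': "q (c *\<^sub>R u) = c * q u" if "0 \<le> c" for c u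
    using scale[of c u] zero that by (cases "c = 0") auto
  have lower: "- q (- x) \<le> q (x + t *\<^sub>R y) - t * q y" if "0 \<le> t" for x t
    using add[of "x + t *\<^sub>R y" "- x"] scale'[OF that, of y] by simp
  have bdd: "bdd_below ((\<lambda>t. q (x + t *\<^sub>R y) - t * q y) ` {0..})" for x
    using lower by (intro bdd_belowI[where m="- q (- x)"]) auto
  have le: "q' x \<le> q (x + t *\<^sub>R y) - t * q y" if "0 \<le> t" for x t
    unfolding q'_def using that by (intro cINF_lower bdd) auto
  have ge: "b \<le> q' x" if "\<And>t. 0 \<le> t \<Longrightarrow> b \<le> q (x + t *\<^sub>R y) - t * q y" for b x
    unfolding q'_def using that by (intro cINF_greatest) auto
  have q'_add: "q' (u + v) \<le> q' u + q' v" for u v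
  proof -
    have *: "q' (u + v) \<le> (q (u + s *\<^sub>R y) - s * q y) + (q (v + t *\<^sub>R y) - t * q y)"
      if "0 \<le> s" "0 \<le> t" for s t
      using le[of "s + t" "u + v"] add[of "u + s *\<^sub>R y" "v + t *\<^sub>R y"] that
      by (simp add: algebra_simps)
    have "q' (u + v) - (q (u + s *\<^sub>R y) - s * q y) \<le> q' v" if "0 \<le> s" for s
      using *[OF that] by (intro ge) (simp add: algebra_simps)
    then have "q' (u + v) - q' v \<le> q' u"
      by (intro ge) (simp add: algebra_simps)
    then show ?thesis by simp
  qed
  have q'_le: "c * q' u \<le> q' (c *\<^sub>R u)" if "0 < c" for c u
  proof (rule ge)
    fix t :: real assume t: "0 \<le> t"
    have "c * q' u \<le> c * (q (u + (t / c) *\<^sub>R y) - (t / c) * q y)"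
      using that t by (intro mult_left_mono le) auto
    also have "\<dots> = q (c *\<^sub>R u + t *\<^sub>R y) - t * q y"
      using scale[OF that, of "u + (t / c) *\<^sub>R y"] that
      by (simp add: algebra_simps)
    finally show "c * q' u \<le> q (c *\<^sub>R u + t *\<^sub>R y) - t * q y" .
  qed
  have q'_scale: "q' (c *\<^sub>R u) = c * q' u" if "0 < c" for c u
    using q'_le[OF that, of u] q'_le[of "1 / c" "c *\<^sub>R u"] that
    by (simp add: field_simps)
  show ?thesis
  proof
    show "sublinear q'" using q'_add q'_scale by (auto simp: sublinear_def)
    show "q' x \<le> q x" for x using le[of 0 x] by simp
    show "q' x \<le> q (x + y) - q y" for x using le[of 1 x] by simp
  qed
qed

theorem ex_norming_functional:
  fixes x0 :: "'a::real_normed_vector"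
  shows "\<exists>f :: 'a \<Rightarrow>\<^sub>L real. norm f \<le> 1 \<and> blinfun_apply f x0 = norm x0"
proof -
  define A where "A = {q. sublinear q \<and> (\<forall>x. q x \<le> norm x) \<and> q (- x0) \<le> - norm x0}"
  have "sublinear (norm :: 'a \<Rightarrow> real)"
    by (auto simp: sublinear_def norm_triangle_ineq)
  then obtain q0 :: "'a \<Rightarrow> real" where h: "sublinear q0" "\<And>x. q0 x \<le> norm x"
    "\<And>x. q0 x \<le> norm (x + x0) - norm x0"
    using sublinear_shift[of norm x0] by metis
  have q0: "q0 \<in> A"
    using h(1,2) h(3)[of "- x0"] by (simp add: A_def)
  let ?P = "\<lambda>q r. \<forall>x. r x \<le> q (x::'a) "
  have lb: "- norm x \<le> q x" if "q \<in> A" for q x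
  proof -
    have "q (- x) \<le> norm (- x)" and "sublinear q" using that unfolding A_def by blast+
    then show ?thesis using sublinear_minus[of q x] by simp
  qed
  have "\<exists>m\<in>A. \<forall>a\<in>A. ?P m a \<longrightarrow> a = m"
  proof (rule predicate_Zorn)
    show "partial_order_on A (relation_of ?P A)"
      by (rule partial_order_on_relation_ofI) (auto intro: order_trans intro!: ext order_antisym)
  next
    fix C assume C: "C \<in> Chains (relation_of ?P A)"
    then have CA: "C \<subseteq> A" and ch: "\<And>q r. q \<in> C \<Longrightarrow> r \<in> C \<Longrightarrow> ?P q r \<or> ?P r q"
      by (auto simp: Chains_def relation_of_def)
    show "\<exists>u\<in>A. \<forall>a\<in>C. ?P a u"
    proof (cases "C = {}")
      case True
      then show ?thesis using q0 by auto
    next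
      case False
      define u where "u = (\<lambda>x. INF q\<in>C. q x)"
      have bdd: "bdd_below ((\<lambda>q. q x) ` C)" for x
        using lb CA by (intro bdd_belowI[where m="- norm x"]) auto
      have le: "u x \<le> q x" if "q \<in> C" for q x
        unfolding u_def using that by (intro cINF_lower bdd) auto
      have ge: "b \<le> u x" if "\<And>q. q \<in> C \<Longrightarrow> b \<le> q x" for b x
        unfolding u_def using that False by (intro cINF_greatest) auto
      have u_add: "u (x + y) \<le> u x + u y" for x y
      proof -
        have *: "u (x + y) \<le> q x + r y" if qr: "q \<in> C" "r \<in> C" for q r
        proof -
          obtain s where s: "s \<in> C" "s x \<le> q x" "s y \<le> r y"
            using ch[OF qr] qr by (metis order_refl)
          have "s (x + y) \<le> s x + s y"
            using s(1) CA by (auto simp: A_def sublinear_def)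
          then show ?thesis using le[OF s(1), of "x + y"] s by linarith
        qed
        have "u (x + y) - q x \<le> u y" if "q \<in> C" for q
          using *[OF that] by (intro ge) (simp add: algebra_simps)
        then have "u (x + y) - u y \<le> u x"
          by (intro ge) (simp add: algebra_simps)
        then show ?thesis by simp
      qed
      have u_le: "c * u x \<le> u (c *\<^sub>R x)" if "0 < c" for c x
      proof (rule ge)
        fix q assume "q \<in> C"
        then show "c * u x \<le> q (c *\<^sub>R x)"
          using le[of q x] CA that by (auto simp: A_def sublinear_def)
      qed
      have u_scale: "u (c *\<^sub>R x) = c * u x" if "0 < c" for c x
        using u_le[OF that, of x] u_le[of "1 / c" "c *\<^sub>R x"] that
        by (simp add: field_simps)
      obtain q where q: "q \<in> C" using False by auto
      then have qA: "\<forall>x. q x \<le> norm x" "q (- x0) \<le> - norm x0"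
        using CA by (auto simp: A_def)
      have "sublinear u"
        using u_add u_scale by (simp add: sublinear_def)
      moreover have "u x \<le> norm x" for x
        using le[OF q, of x] qA(1) by (meson order_trans)
      moreover have "u (- x0) \<le> - norm x0"
        using le[OF q, of "- x0"] qA(2) by linarith
      ultimately have "u \<in> A" by (simp add: A_def)
      then show ?thesis using le by auto
    qed
  qed
  then obtain m where m: "m \<in> A" and min: "\<And>a. a \<in> A \<Longrightarrow> ?P m a \<Longrightarrow> a = m" by blast
  have sub: "sublinear m" using m by (simp add: A_def)
  have add: "m (x + y) = m x + m y" for x y
  proof -
    obtain a where a: "sublinear a" "\<And>x. a x \<le> m x" "\<And>x. a x \<le> m (x + y) - m y"
      using sublinear_shift[OF sub, of y] by blast
    have "a x \<le> norm x" for x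
      using a(2)[of x] m unfolding A_def by (metis (mono_tags, lifting) mem_Collect_eq order_trans)
    moreover have "a (- x0) \<le> - norm x0"
      using a(2)[of "- x0"] m by (simp add: A_def)
    ultimately have "a \<in> A" using a(1) by (simp add: A_def)
    then have "a = m" using min a by blast
    then have "m x \<le> m (x + y) - m y" using a(3) by blast
    moreover have "m (x + y) \<le> m x + m y" using sub by (simp add: sublinear_def)
    ultimately show ?thesis by simp
  qed
  have minus: "m (- x) = - m x" for x
    using add[of x "- x"] sublinear_zero[OF sub] by simp
  have scale: "m (c *\<^sub>R x) = c * m x" for c x
  proof (cases c "0 :: real" rule: linorder_cases)
    case less
    have "m (d *\<^sub>R x) = d * m x" if "0 < d" for d
      using sub that by (simp add: sublinear_def)
    from this[of "- c"] show ?thesis using less minus[of "c *\<^sub>R x"] by simp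
  qed (use sub sublinear_zero[OF sub] in \<open>auto simp: sublinear_def\<close>)
  have bound: "\<bar>m x\<bar> \<le> norm x" for x
  proof -
    have "m x \<le> norm x" "m (- x) \<le> norm (- x)" using m unfolding A_def by blast+
    then show ?thesis using minus[of x] by simp
  qed
  have bl: "bounded_linear m"
    using add scale bound by (intro bounded_linear_intro[where K=1]) auto
  have "m x0 = norm x0"
    using m minus[of x0] bound[of x0] by (auto simp: A_def)
  moreover have "norm (Blinfun m) \<le> 1"
    by (rule norm_blinfun_bound) (auto simp: bounded_linear_Blinfun_apply[OF bl] bound)
  ultimately show ?thesis
    using bounded_linear_Blinfun_apply[OF bl] by (intro exI[of _ "Blinfun m"]) auto
qed

lemma subspace_closure:
  fixes S :: "'a::real_normed_vector set"
  assumes "subspace S"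
  shows "subspace (closure S)"
proof (rule subspaceI)
  show "0 \<in> closure S"
    using subspace_0[OF assms] closure_subset by blast
next
  fix x y assume "x \<in> closure S" "y \<in> closure S"
  then obtain f g where "\<And>n. f n \<in> S" "f \<longlonglongrightarrow> x" "\<And>n. g n \<in> S" "g \<longlonglongrightarrow> y"
    unfolding closure_sequential by blast
  then show "x + y \<in> closure S"
    unfolding closure_sequential
    by (intro exI[of _ "\<lambda>n. f n + g n"]) (auto intro: subspace_add[OF assms] tendsto_add)
next
  fix c :: real and x assume "x \<in> closure S"
  then obtain f where "\<And>n. f n \<in> S" "f \<longlonglongrightarrow> x"
    unfolding closure_sequential by blast
  then show "c *\<^sub>R x \<in> closure S"
    unfolding closure_sequential
    by (intro exI[of _ "\<lambda>n. c *\<^sub>R f n"]) (auto intro: subspace_scale[OF assms] tendsto_intros)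
qed


section \<open>The completion of a normed space\<close>

lift_definition bidual_embed :: "'a::real_normed_vector \<Rightarrow> ('a \<Rightarrow>\<^sub>L real) \<Rightarrow>\<^sub>L real"
  is "\<lambda>x f. blinfun_apply f x"
  by (rule bounded_bilinear.bounded_linear_left[OF bounded_bilinear_blinfun_apply])

lemma linear_bidual_embed: "linear bidual_embed"
  by (rule linearI; rule blinfun_eqI)
    (simp_all add: bidual_embed.rep_eq plus_blinfun.rep_eq scaleR_blinfun.rep_eq
      blinfun.add_right blinfun.scaleR_right)

lemma norm_bidual_embed: "norm (bidual_embed x) = norm x"
proof (rule antisym)
  show "norm (bidual_embed x) \<le> norm x"
  proof (rule norm_blinfun_bound)
    show "norm (blinfun_apply (bidual_embed x) f) \<le> norm x * norm f" for f
      using norm_blinfun[of f x] by (simp add: bidual_embed.rep_eq mult.commute)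
  qed simp
  obtain f :: "'a \<Rightarrow>\<^sub>L real" where f: "norm f \<le> 1" "blinfun_apply f x = norm x"
    using ex_norming_functional by blast
  have "norm x = norm (blinfun_apply (bidual_embed x) f)"
    using f by (simp add: bidual_embed.rep_eq)
  also have "\<dots> \<le> norm (bidual_embed x) * norm f" by (rule norm_blinfun)
  also have "\<dots> \<le> norm (bidual_embed x) * 1" using f by (intro mult_left_mono) auto
  finally show "norm x \<le> norm (bidual_embed x)" by simp
qed

text \<open>
  The closure of the canonical image in the bidual; the lemmas after the class instances state
  that \<open>to_completion\<close> is a linear isometry onto a dense subspace of a Banach space.
\<close>

typedef (overloaded) 'a completion =
    "closure (range bidual_embed) :: (('a::real_normed_vector \<Rightarrow>\<^sub>L real) \<Rightarrow>\<^sub>L real) set"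
  by (rule exI, rule closure_subset[THEN subsetD, OF rangeI])

setup_lifting type_definition_completion

lemma subspace_completion:
  "subspace (closure (range (bidual_embed :: 'a::real_normed_vector \<Rightarrow> _)))"
  by (intro subspace_closure linear_subspace_image linear_bidual_embed subspace_UNIV)

instantiation completion :: (real_normed_vector) real_vector
begin

lift_definition zero_completion :: "'a completion" is 0
  by (rule subspace_0[OF subspace_completion])
lift_definition plus_completion :: "'a completion \<Rightarrow> 'a completion \<Rightarrow> 'a completion" is "(+)"
  by (rule subspace_add[OF subspace_completion])
lift_definition minus_completion :: "'a completion \<Rightarrow> 'a completion \<Rightarrow> 'a completion" is "(-)"
  by (rule subspace_diff[OF subspace_completion])
lift_definition uminus_completion :: "'a completion \<Rightarrow> 'a completion" is uminus
  by (rule subspace_neg[OF subspace_completion])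
lift_definition scaleR_completion :: "real \<Rightarrow> 'a completion \<Rightarrow> 'a completion" is "scaleR"
  by (rule subspace_scale[OF subspace_completion])

instance
  by standard (transfer; simp add: algebra_simps)+

end

instantiation completion :: (real_normed_vector) real_normed_vector
begin

lift_definition norm_completion :: "'a completion \<Rightarrow> real" is norm .
definition dist_completion :: "'a completion \<Rightarrow> 'a completion \<Rightarrow> real" where
  "dist_completion u v = norm (u - v)"
definition sgn_completion :: "'a completion \<Rightarrow> 'a completion" where
  "sgn_completion u = inverse (norm u) *\<^sub>R u"
definition uniformity_completion :: "('a completion \<times> 'a completion) filter" where
  "uniformity_completion = (INF e\<in>{0<..}. principal {(u, v). dist u v < e})"
definition open_completion :: "'a completion set \<Rightarrow> bool" where
  "open_completion U \<longleftrightarrow> (\<forall>u\<in>U. eventually (\<lambda>(u', v). u' = u \<longrightarrow> v \<in> U) uniformity)"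

instance
proof
  fix u v :: "'a completion" and c :: real
  show "norm u = 0 \<longleftrightarrow> u = 0" by transfer simp
  show "norm (u + v) \<le> norm u + norm v" by transfer (rule norm_triangle_ineq)
  show "norm (c *\<^sub>R u) = \<bar>c\<bar> * norm u" by transfer simp
qed (simp_all add: dist_completion_def sgn_completion_def uniformity_completion_def open_completion_def)

end

instance completion :: (real_normed_vector) banach
proof
  fix X :: "nat \<Rightarrow> 'a completion"
  assume X: "Cauchy X"
  have dist_eq: "dist u v = dist (Rep_completion u) (Rep_completion v)" for u v :: "'a completion"
    by (simp add: dist_norm norm_completion.rep_eq minus_completion.rep_eq)
  have "Cauchy (\<lambda>n. Rep_completion (X n))"
    using X by (simp add: Cauchy_def dist_eq)
  then obtain l where l: "(\<lambda>n. Rep_completion (X n)) \<longlonglongrightarrow> l"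
    using Cauchy_convergent unfolding convergent_def by metis
  have "l \<in> closure (range bidual_embed)"
    by (rule closed_sequentially[OF closed_closure _ l]) (rule Rep_completion)
  then have "Rep_completion (Abs_completion l) = l"
    by (rule Abs_completion_inverse)
  then have "X \<longlonglongrightarrow> Abs_completion l"
    using l by (simp add: tendsto_iff dist_eq)
  then show "convergent X" by (rule convergentI)
qed

lift_definition to_completion :: "'a::real_normed_vector \<Rightarrow> 'a completion" is bidual_embed
  by (rule closure_subset[THEN subsetD, OF rangeI])

lemma linear_to_completion: "linear to_completion"
  by (rule linearI; transfer)
    (simp_all add: linear_add[OF linear_bidual_embed] linear_scale[OF linear_bidual_embed])

lemma norm_to_completion: "norm (to_completion x) = norm x"
  by transfer (rule norm_bidual_embed)

lemma dense_range_to_completion: "closure (range to_completion) = UNIV"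
proof -
  have "u \<in> closure (range to_completion)" for u :: "'a completion"
  proof -
    obtain f where f: "\<And>n. f n \<in> range bidual_embed" "f \<longlonglongrightarrow> Rep_completion u"
      using Rep_completion[of u] unfolding closure_sequential by metis
    from f(1) have "\<forall>n. \<exists>y. f n = bidual_embed y" by blast
    then obtain x where x: "\<And>n. f n = bidual_embed (x n)" by metis
    have "(\<lambda>n. to_completion (x n)) \<longlonglongrightarrow> u"
      using f(2) by (simp add: tendsto_iff dist_norm norm_completion.rep_eq minus_completion.rep_eq
          to_completion.rep_eq x)
    then show ?thesis
      unfolding closure_sequential by (intro exI[of _ "\<lambda>n. to_completion (x n)"]) simp
  qed
  then show ?thesis by auto
qed


section \<open>Lipschitz functions vanishing at the origin and the Lipschitz-free space\<close>

typedef (overloaded) 'a lip0 =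
    "{f :: 'a::real_normed_vector \<Rightarrow> real. f 0 = 0 \<and> (\<exists>C. C-lipschitz_on UNIV f)}"
  morphisms lip0_apply Lip0
  by (rule exI[of _ "\<lambda>_. 0"]) (auto intro!: exI[of _ 0] lipschitz_onI)

setup_lifting type_definition_lip0

lemma lip0_zero [simp]: "lip0_apply f 0 = 0"
  using lip0_apply[of f] by simp

instantiation lip0 :: (real_normed_vector) real_vector
begin

lift_definition zero_lip0 :: "'a lip0" is "\<lambda>_. 0"
  by (auto intro!: exI[of _ 0] lipschitz_onI)
lift_definition plus_lip0 :: "'a lip0 \<Rightarrow> 'a lip0 \<Rightarrow> 'a lip0" is "\<lambda>f g x. f x + g x"
  by (auto intro: lipschitz_on_add)
lift_definition minus_lip0 :: "'a lip0 \<Rightarrow> 'a lip0 \<Rightarrow> 'a lip0" is "\<lambda>f g x. f x - g x"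
  by (auto intro: lipschitz_on_diff)
lift_definition uminus_lip0 :: "'a lip0 \<Rightarrow> 'a lip0" is "\<lambda>f x. - f x"
  by (auto intro: lipschitz_on_minus)
lift_definition scaleR_lip0 :: "real \<Rightarrow> 'a lip0 \<Rightarrow> 'a lip0" is "\<lambda>c f x. c * f x"
  by (auto intro: lipschitz_on_cmult_real)

instance
  by standard (transfer; simp add: algebra_simps fun_eq_iff)+

end

lift_definition lip_const :: "'a::real_normed_vector lip0 \<Rightarrow> real"
  is "\<lambda>f. Inf {C. C-lipschitz_on UNIV f}" .

lemma lipschitz_on_lip_const: "(lip_const f)-lipschitz_on UNIV (lip0_apply f)"
proof -
  let ?C = "{C. C-lipschitz_on UNIV (lip0_apply f)}"
  have ne: "?C \<noteq> {}" using lip0_apply[of f] by auto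
  have nonneg: "0 \<le> C" if "C \<in> ?C" for C using that by (auto dest: lipschitz_on_nonneg)
  show ?thesis
  proof (rule lipschitz_onI)
    show "0 \<le> lip_const f"
      unfolding lip_const.rep_eq using nonneg by (intro cInf_greatest[OF ne])
    show "dist (lip0_apply f x) (lip0_apply f y) \<le> lip_const f * dist x y" for x y
    proof (cases "x = y")
      case False
      have "dist (lip0_apply f x) (lip0_apply f y) / dist x y \<le> lip_const f"
        unfolding lip_const.rep_eq
      proof (rule cInf_greatest[OF ne])
        fix C assume "C \<in> ?C"
        then have "dist (lip0_apply f x) (lip0_apply f y) \<le> C * dist x y"
          by (auto dest: lipschitz_onD)
        then show "dist (lip0_apply f x) (lip0_apply f y) / dist x y \<le> C"
          using False by (simp add: divide_le_eq)
      qed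
      then show ?thesis using False by (simp add: divide_le_eq)
    qed simp
  qed
qed

lemma lip_const_le:
  assumes "C-lipschitz_on UNIV (lip0_apply f)"
  shows "lip_const f \<le> C"
  unfolding lip_const.rep_eq
  using assms by (intro cInf_lower) (auto intro!: bdd_belowI[of _ 0] dest: lipschitz_on_nonneg)

instantiation lip0 :: (real_normed_vector) real_normed_vector
begin

definition norm_lip0 :: "'a lip0 \<Rightarrow> real" where
  "norm_lip0 = lip_const"
definition dist_lip0 :: "'a lip0 \<Rightarrow> 'a lip0 \<Rightarrow> real" where
  "dist_lip0 u v = norm (u - v)"
definition sgn_lip0 :: "'a lip0 \<Rightarrow> 'a lip0" where
  "sgn_lip0 u = inverse (norm u) *\<^sub>R u"
definition uniformity_lip0 :: "('a lip0 \<times> 'a lip0) filter" where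
  "uniformity_lip0 = (INF e\<in>{0<..}. principal {(u, v). dist u v < e})"
definition open_lip0 :: "'a lip0 set \<Rightarrow> bool" where
  "open_lip0 U \<longleftrightarrow> (\<forall>u\<in>U. eventually (\<lambda>(u', v). u' = u \<longrightarrow> v \<in> U) uniformity)"

instance
proof
  have lipschitz_on_lip0: "(norm f)-lipschitz_on UNIV (lip0_apply f)" for f :: "'a lip0"
    unfolding norm_lip0_def by (rule lipschitz_on_lip_const)
  have norm_lip0_le: "norm f \<le> C" if "C-lipschitz_on UNIV (lip0_apply f)" for f :: "'a lip0" and C
    unfolding norm_lip0_def using that by (rule lip_const_le)
  fix f g :: "'a lip0" and c :: real
  show "norm f = 0 \<longleftrightarrow> f = 0"
  proof
    assume "norm f = 0"
    then have "lip0_apply f x = 0" for x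
      using lipschitz_onD[OF lipschitz_on_lip0, of x 0 f] by simp
    then show "f = 0" by transfer auto
  next
    assume "f = 0"
    then have "norm f \<le> 0"
      by (intro norm_lip0_le) (auto simp: zero_lip0.rep_eq intro: lipschitz_onI)
    then show "norm f = 0" using lipschitz_on_nonneg[OF lipschitz_on_lip0, of f] by simp
  qed
  show "norm (f + g) \<le> norm f + norm g"
    by (intro norm_lip0_le)
      (simp add: plus_lip0.rep_eq lipschitz_on_add lipschitz_on_lip0)
  have scale: "norm (c *\<^sub>R f) \<le> \<bar>c\<bar> * norm f" for c and f :: "'a lip0"
    using lipschitz_on_cmult_real[OF lipschitz_on_lip0, of c f]
    by (intro norm_lip0_le) (simp add: scaleR_lip0.rep_eq)
  show "norm (c *\<^sub>R f) = \<bar>c\<bar> * norm f"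
  proof (cases "c = 0")
    case True
    then show ?thesis
      using scale[of 0 f] lipschitz_on_nonneg[OF lipschitz_on_lip0, of "0 *\<^sub>R f"] by simp
  next
    case False
    have "norm f \<le> \<bar>inverse c\<bar> * norm (c *\<^sub>R f)"
      using scale[of "inverse c" "c *\<^sub>R f"] False by simp
    then show ?thesis
      using scale[of c f] False by (simp add: field_simps abs_if split: if_splits)
  qed
qed (simp_all add: dist_lip0_def sgn_lip0_def uniformity_lip0_def open_lip0_def)

end

lift_definition eval_functional :: "'a::real_normed_vector \<Rightarrow> 'a lip0 \<Rightarrow>\<^sub>L real"
  is "\<lambda>x f. lip0_apply f x"
proof (rule bounded_linear_intro)
  fix x :: 'a and f :: "'a lip0"
  show "norm (lip0_apply f x) \<le> norm f * norm x"
    unfolding norm_lip0_def using lipschitz_onD[OF lipschitz_on_lip_const, of x 0 f] by simp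
qed (simp_all add: plus_lip0.rep_eq scaleR_lip0.rep_eq)

typedef (overloaded) 'a lip_free =
    "closure (span (range eval_functional)) :: ('a::real_normed_vector lip0 \<Rightarrow>\<^sub>L real) set"
  by (meson closure_subset subsetD span_zero)

setup_lifting type_definition_lip_free

lemma subspace_lip_free:
  "subspace (closure (span (range (eval_functional :: 'a::real_normed_vector \<Rightarrow> _))))"
  by (intro subspace_closure subspace_span)

instantiation lip_free :: (real_normed_vector) real_vector
begin

lift_definition zero_lip_free :: "'a lip_free" is 0
  by (rule subspace_0[OF subspace_lip_free])
lift_definition plus_lip_free :: "'a lip_free \<Rightarrow> 'a lip_free \<Rightarrow> 'a lip_free" is "(+)"
  by (rule subspace_add[OF subspace_lip_free])
lift_definition minus_lip_free :: "'a lip_free \<Rightarrow> 'a lip_free \<Rightarrow> 'a lip_free" is "(-)"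
  by (rule subspace_diff[OF subspace_lip_free])
lift_definition uminus_lip_free :: "'a lip_free \<Rightarrow> 'a lip_free" is uminus
  by (rule subspace_neg[OF subspace_lip_free])
lift_definition scaleR_lip_free :: "real \<Rightarrow> 'a lip_free \<Rightarrow> 'a lip_free" is "scaleR"
  by (rule subspace_scale[OF subspace_lip_free])

instance
  by standard (transfer; simp add: algebra_simps)+

end

instantiation lip_free :: (real_normed_vector) real_normed_vector
begin

lift_definition norm_lip_free :: "'a lip_free \<Rightarrow> real" is norm .
definition dist_lip_free :: "'a lip_free \<Rightarrow> 'a lip_free \<Rightarrow> real" where
  "dist_lip_free u v = norm (u - v)"
definition sgn_lip_free :: "'a lip_free \<Rightarrow> 'a lip_free" where
  "sgn_lip_free u = inverse (norm u) *\<^sub>R u"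
definition uniformity_lip_free :: "('a lip_free \<times> 'a lip_free) filter" where
  "uniformity_lip_free = (INF e\<in>{0<..}. principal {(u, v). dist u v < e})"
definition open_lip_free :: "'a lip_free set \<Rightarrow> bool" where
  "open_lip_free U \<longleftrightarrow> (\<forall>u\<in>U. eventually (\<lambda>(u', v). u' = u \<longrightarrow> v \<in> U) uniformity)"

instance
proof
  fix u v :: "'a lip_free" and c :: real
  show "norm u = 0 \<longleftrightarrow> u = 0" by transfer simp
  show "norm (u + v) \<le> norm u + norm v" by transfer (rule norm_triangle_ineq)
  show "norm (c *\<^sub>R u) = \<bar>c\<bar> * norm u" by transfer simp
qed (simp_all add: dist_lip_free_def sgn_lip_free_def uniformity_lip_free_def open_lip_free_def)

end

instance lip_free :: (real_normed_vector) banach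
proof
  fix X :: "nat \<Rightarrow> 'a lip_free"
  assume X: "Cauchy X"
  have dist_eq: "dist u v = dist (Rep_lip_free u) (Rep_lip_free v)" for u v :: "'a lip_free"
    by (simp add: dist_norm norm_lip_free.rep_eq minus_lip_free.rep_eq)
  have "Cauchy (\<lambda>n. Rep_lip_free (X n))"
    using X by (simp add: Cauchy_def dist_eq)
  then obtain l where l: "(\<lambda>n. Rep_lip_free (X n)) \<longlonglongrightarrow> l"
    using Cauchy_convergent unfolding convergent_def by metis
  have "l \<in> closure (span (range eval_functional))"
    by (rule closed_sequentially[OF closed_closure _ l]) (rule Rep_lip_free)
  then have "Rep_lip_free (Abs_lip_free l) = l"
    by (rule Abs_lip_free_inverse)
  then have "X \<longlonglongrightarrow> Abs_lip_free l"
    using l by (simp add: tendsto_iff dist_eq)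
  then show "convergent X" by (rule convergentI)
qed

lift_definition delta :: "'a::real_normed_vector \<Rightarrow> 'a lip_free" is eval_functional
  by (meson closure_subset subsetD span_base rangeI)


section \<open>The projective tensor product\<close>

instantiation poly_mapping :: (type, real_vector) real_vector
begin

lift_definition scaleR_poly_mapping :: "real \<Rightarrow> ('a \<Rightarrow>\<^sub>0 'b) \<Rightarrow> 'a \<Rightarrow>\<^sub>0 'b"
  is "\<lambda>c f k. c *\<^sub>R f k"
  by (rule finite_subset) auto

instance
  by standard (transfer; simp add: algebra_simps fun_eq_iff)+

end

text \<open>
  \<open>('a \<times> 'b) \<Rightarrow>\<^sub>0 real\<close> is the free real vector space on \<open>'a \<times> 'b\<close>; dividing out the bilinear
  relations gives the algebraic tensor product.
\<close>

definition bilinear_relations ::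
    "(('a::real_vector \<times> 'b::real_vector) \<Rightarrow>\<^sub>0 real) set" where
  "bilinear_relations = span (
     {Poly_Mapping.single (x + x', y) 1 - Poly_Mapping.single (x, y) 1
        - Poly_Mapping.single (x', y) 1 | x x' y. True} \<union>
     {Poly_Mapping.single (x, y + y') 1 - Poly_Mapping.single (x, y) 1
        - Poly_Mapping.single (x, y') 1 | x y y'. True} \<union>
     {Poly_Mapping.single (c *\<^sub>R x, y) 1 - c *\<^sub>R Poly_Mapping.single (x, y) 1 | c x y. True} \<union>
     {Poly_Mapping.single (x, c *\<^sub>R y) 1 - c *\<^sub>R Poly_Mapping.single (x, y) 1 | c x y. True})"

lemma subspace_bilinear_relations: "subspace bilinear_relations"
  unfolding bilinear_relations_def by (rule subspace_span)

lemma subspace_cong: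
  assumes S: "subspace S"
  shows subspace_cong_equivp: "equivp (\<lambda>u v. u - v \<in> S)"
    and subspace_cong_add: "u - u' \<in> S \<Longrightarrow> v - v' \<in> S \<Longrightarrow> (u + v) - (u' + v') \<in> S"
    and subspace_cong_diff: "u - u' \<in> S \<Longrightarrow> v - v' \<in> S \<Longrightarrow> (u - v) - (u' - v') \<in> S"
    and subspace_cong_minus: "u - u' \<in> S \<Longrightarrow> (- u) - (- u') \<in> S"
    and subspace_cong_scale: "u - u' \<in> S \<Longrightarrow> c *\<^sub>R u - c *\<^sub>R u' \<in> S"
proof -
  show add: "(u + v) - (u' + v') \<in> S" if "u - u' \<in> S" "v - v' \<in> S" for u u' v v'
    using subspace_add[OF S that] by (simp add: algebra_simps)
  show "(u - v) - (u' - v') \<in> S" if "u - u' \<in> S" "v - v' \<in> S" for u u' v v'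
    using subspace_diff[OF S that] by (simp add: algebra_simps)
  show minus: "(- u) - (- u') \<in> S" if "u - u' \<in> S" for u u'
    using subspace_neg[OF S that] by simp
  show "c *\<^sub>R u - c *\<^sub>R u' \<in> S" if "u - u' \<in> S" for u u'
    using subspace_scale[OF S that, of c] by (simp add: scaleR_right_diff_distrib)
  show "equivp (\<lambda>u v. u - v \<in> S)"
  proof (intro equivpI reflpI sympI transpI)
    show "u - u \<in> S" for u using subspace_0[OF S] by simp
    show "v - u \<in> S" if "u - v \<in> S" for u v using minus[OF that] by simp
    show "u - w \<in> S" if "u - v \<in> S" "v - w \<in> S" for u v w
      using add[OF that] by simp
  qed
qed

quotient_type (overloaded) ('a, 'b) tensor =
    "('a::real_vector \<times> 'b::real_vector) \<Rightarrow>\<^sub>0 real" / "\<lambda>u v. u - v \<in> bilinear_relations"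
  by (rule subspace_cong_equivp[OF subspace_bilinear_relations])

instantiation tensor :: (real_vector, real_vector) real_vector
begin

lift_definition zero_tensor :: "('a, 'b) tensor" is 0 .
lift_definition plus_tensor :: "('a, 'b) tensor \<Rightarrow> ('a, 'b) tensor \<Rightarrow> ('a, 'b) tensor" is "(+)"
  by (rule subspace_cong_add[OF subspace_bilinear_relations])
lift_definition minus_tensor :: "('a, 'b) tensor \<Rightarrow> ('a, 'b) tensor \<Rightarrow> ('a, 'b) tensor" is "(-)"
  by (rule subspace_cong_diff[OF subspace_bilinear_relations])
lift_definition uminus_tensor :: "('a, 'b) tensor \<Rightarrow> ('a, 'b) tensor" is uminus
  by (rule subspace_cong_minus[OF subspace_bilinear_relations])
lift_definition scaleR_tensor :: "real \<Rightarrow> ('a, 'b) tensor \<Rightarrow> ('a, 'b) tensor" is scaleR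
  by (rule subspace_cong_scale[OF subspace_bilinear_relations])

instance
  by standard
    (transfer; simp add: algebra_simps subspace_0[OF subspace_bilinear_relations])+

end

lift_definition tensor_elem :: "'a::real_vector \<Rightarrow> 'b::real_vector \<Rightarrow> ('a, 'b) tensor"
  is "\<lambda>x y. Poly_Mapping.single (x, y) 1" .

lemma bilinear_tensor_elem: "bilinear tensor_elem"
  unfolding bilinear_def
proof (intro conjI allI linearI)
  fix x x' :: 'a and y y' :: 'b and c :: real
  show "tensor_elem x (y + y') = tensor_elem x y + tensor_elem x y'"
    by transfer (unfold bilinear_relations_def diff_diff_eq[symmetric], rule span_base, blast)
  show "tensor_elem (x + x') y = tensor_elem x y + tensor_elem x' y"
    by transfer (unfold bilinear_relations_def diff_diff_eq[symmetric], rule span_base, blast)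
  show "tensor_elem x (c *\<^sub>R y) = c *\<^sub>R tensor_elem x y"
    by transfer (unfold bilinear_relations_def, rule span_base, blast)
  show "tensor_elem (c *\<^sub>R x) y = c *\<^sub>R tensor_elem x y"
    by transfer (unfold bilinear_relations_def, rule span_base, blast)
qed

lemma ex_linear_poly_mapping:
  fixes g :: "'k \<Rightarrow> 'c::real_vector"
  shows "\<exists>L :: ('k \<Rightarrow>\<^sub>0 real) \<Rightarrow> 'c. linear L \<and> (\<forall>k. L (Poly_Mapping.single k 1) = g k)"
proof -
  define L where "L = (\<lambda>u :: 'k \<Rightarrow>\<^sub>0 real. \<Sum>k\<in>Poly_Mapping.keys u. Poly_Mapping.lookup u k *\<^sub>R g k)"
  have L: "L u = (\<Sum>k\<in>A. Poly_Mapping.lookup u k *\<^sub>R g k)"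
    if "finite A" "Poly_Mapping.keys u \<subseteq> A" for u A
    unfolding L_def using that by (intro sum.mono_neutral_left) (auto simp: in_keys_iff)
  have lookup_scale: "Poly_Mapping.lookup (c *\<^sub>R u) k = c * Poly_Mapping.lookup u k"
    for c and u :: "'k \<Rightarrow>\<^sub>0 real" and k
    by (simp add: scaleR_poly_mapping.rep_eq)
  have "linear L"
  proof (rule linearI)
    fix u v :: "'k \<Rightarrow>\<^sub>0 real" and c :: real
    let ?A = "Poly_Mapping.keys u \<union> Poly_Mapping.keys v"
    show "L (u + v) = L u + L v"
      using keys_add[of u v] L[of ?A u] L[of ?A v] L[of ?A "u + v"]
      by (simp add: lookup_add scaleR_left_distrib sum.distrib)
    have "Poly_Mapping.keys (c *\<^sub>R u) \<subseteq> Poly_Mapping.keys u"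
      by (auto simp: in_keys_iff lookup_scale)
    then show "L (c *\<^sub>R u) = c *\<^sub>R L u"
      using L[of "Poly_Mapping.keys u" "c *\<^sub>R u"] L[of "Poly_Mapping.keys u" u]
      by (simp add: lookup_scale scaleR_sum_right)
  qed
  moreover have "L (Poly_Mapping.single k 1) = g k" for k
    unfolding L_def by simp
  ultimately show ?thesis by blast
qed

lemma tensor_universal:
  fixes B :: "'a::real_vector \<Rightarrow> 'b::real_vector \<Rightarrow> 'c::real_vector"
  assumes B: "bilinear B"
  shows "\<exists>L :: ('a, 'b) tensor \<Rightarrow> 'c. linear L \<and> (\<forall>x y. L (tensor_elem x y) = B x y)"
proof -
  obtain L0 :: "(('a \<times> 'b) \<Rightarrow>\<^sub>0 real) \<Rightarrow> 'c" where L0: "linear L0"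
    and L0_single: "\<And>x y. L0 (Poly_Mapping.single (x, y) 1) = B x y"
    using ex_linear_poly_mapping[of "\<lambda>(x, y). B x y"] by auto
  have ker: "L0 u = 0" if "u \<in> bilinear_relations" for u
    using that unfolding bilinear_relations_def
  proof (rule span_induct)
    show "subspace {u. L0 u = 0}" by (rule linear_subspace_kernel[OF L0])
  qed (auto simp: linear_diff[OF L0] linear_scale[OF L0] L0_single
      bilinear_ladd[OF B] bilinear_radd[OF B] bilinear_lmul[OF B] bilinear_rmul[OF B])
  have "L0 u = L0 v" if "u - v \<in> bilinear_relations" for u v
    using ker[OF that] by (simp add: linear_diff[OF L0])
  define L where "L = (\<lambda>u. L0 (rep_tensor u))"
  have L_abs: "L (abs_tensor u) = L0 u" for u
  proof -
    have "rep_tensor (abs_tensor u) - u \<in> bilinear_relations"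
      unfolding tensor.abs_eq_iff[symmetric] by (rule Quotient_abs_rep[OF Quotient_tensor])
    from ker[OF this] show ?thesis by (simp add: L_def linear_diff[OF L0])
  qed
  have "linear L"
  proof (rule linearI)
    fix u v :: "('a, 'b) tensor" and c :: real
    show "L (u + v) = L u + L v"
      by (induct u rule: tensor.abs_induct, induct v rule: tensor.abs_induct)
        (simp add: plus_tensor.abs_eq L_abs linear_add[OF L0])
    show "L (c *\<^sub>R u) = c *\<^sub>R L u"
      by (induct u rule: tensor.abs_induct) (simp add: scaleR_tensor.abs_eq L_abs linear_scale[OF L0])
  qed
  moreover have "L (tensor_elem x y) = B x y" for x y
    by (simp add: tensor_elem.abs_eq L_abs L0_single)
  ultimately show ?thesis by blast
qed

lemma tensor_eq_sum_list:
  "\<exists>xs. u = (\<Sum>(x, y)\<leftarrow>xs. tensor_elem x y)"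
proof (induction u rule: tensor.abs_induct)
  case (1 u)
  show ?case
  proof (induction u rule: update_induct)
    case const
    show ?case by (rule exI[of _ "[]"]) (simp add: zero_tensor.abs_eq)
  next
    case (update f a b)
    obtain x y where a: "a = (x, y)" by (cases a)
    obtain xs where xs: "abs_tensor f = (\<Sum>(x, y)\<leftarrow>xs. tensor_elem x y)"
      using update by blast
    have "Poly_Mapping.update a b f = b *\<^sub>R Poly_Mapping.single (x, y) 1 + f"
      using update(1) by (intro poly_mapping_eqI)
        (auto simp: a lookup_add lookup_single scaleR_poly_mapping.rep_eq lookup_update in_keys_iff when_def)
    then have "abs_tensor (Poly_Mapping.update a b f) = tensor_elem (b *\<^sub>R x) y + abs_tensor f"
      by (simp add: plus_tensor.abs_eq[symmetric] scaleR_tensor.abs_eq[symmetric]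
          tensor_elem.abs_eq[symmetric] bilinear_lmul[OF bilinear_tensor_elem])
    then show ?case
      using xs by (intro exI[of _ "(b *\<^sub>R x, y) # xs"]) simp
  qed
qed

definition projective_norm :: "('a::real_normed_vector, 'b::real_normed_vector) tensor \<Rightarrow> real" where
  "projective_norm u =
     Inf {\<Sum>(x, y)\<leftarrow>xs. norm x * norm y | xs. u = (\<Sum>(x, y)\<leftarrow>xs. tensor_elem x y)}"

lemma sum_list_norm_nonneg: "0 \<le> (\<Sum>(x, y)\<leftarrow>xs. norm x * norm y)"
  by (intro sum_list_nonneg) auto

lemma projective_norm_le:
  "projective_norm (\<Sum>(x, y)\<leftarrow>xs. tensor_elem x y) \<le> (\<Sum>(x, y)\<leftarrow>xs. norm x * norm y)"
  unfolding projective_norm_def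
  by (intro cInf_lower) (auto intro!: bdd_belowI[of _ 0] sum_list_norm_nonneg)

lemma projective_norm_ge:
  assumes "\<And>xs. u = (\<Sum>(x, y)\<leftarrow>xs. tensor_elem x y) \<Longrightarrow> b \<le> (\<Sum>(x, y)\<leftarrow>xs. norm x * norm y)"
  shows "b \<le> projective_norm u"
  unfolding projective_norm_def
  using tensor_eq_sum_list[of u] assms by (intro cInf_greatest) auto

lemma projective_norm_nonneg: "0 \<le> projective_norm u"
  by (intro projective_norm_ge sum_list_norm_nonneg)

lemma projective_norm_add: "projective_norm (u + v) \<le> projective_norm u + projective_norm v"
proof -
  have *: "projective_norm (u + v) \<le> (\<Sum>(x, y)\<leftarrow>xs. norm x * norm y) + (\<Sum>(x, y)\<leftarrow>ys. norm x * norm y)"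
    if "u = (\<Sum>(x, y)\<leftarrow>xs. tensor_elem x y)" "v = (\<Sum>(x, y)\<leftarrow>ys. tensor_elem x y)" for xs ys
    using projective_norm_le[of "xs @ ys"] that by simp
  have "projective_norm (u + v) - (\<Sum>(x, y)\<leftarrow>xs. norm x * norm y) \<le> projective_norm v"
    if "u = (\<Sum>(x, y)\<leftarrow>xs. tensor_elem x y)" for xs
    using *[OF that] by (intro projective_norm_ge) (simp add: algebra_simps)
  then have "projective_norm (u + v) - projective_norm v \<le> projective_norm u"
    by (intro projective_norm_ge) (simp add: algebra_simps)
  then show ?thesis by simp
qed

lemma projective_norm_scale_le: "projective_norm (c *\<^sub>R u) \<le> \<bar>c\<bar> * projective_norm u"
proof (cases "c = 0")
  case True
  then show ?thesis using projective_norm_le[of "[]"] by simp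
next
  case False
  have "projective_norm (c *\<^sub>R u) / \<bar>c\<bar> \<le> projective_norm u"
  proof (rule projective_norm_ge)
    fix xs :: "('a \<times> 'b) list"
    assume u: "u = (\<Sum>(x, y)\<leftarrow>xs. tensor_elem x y)"
    let ?ys = "map (\<lambda>(x, y). (c *\<^sub>R x, y)) xs"
    have "c *\<^sub>R (\<Sum>(x, y)\<leftarrow>xs. tensor_elem x y) = (\<Sum>(x, y)\<leftarrow>?ys. tensor_elem x y)"
      by (induction xs) (auto simp: scaleR_right_distrib bilinear_lmul[OF bilinear_tensor_elem])
    moreover have "(\<Sum>(x, y)\<leftarrow>?ys. norm x * norm y) = \<bar>c\<bar> * (\<Sum>(x, y)\<leftarrow>xs. norm x * norm y)"
      by (induction xs) (auto simp: algebra_simps)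
    ultimately show "projective_norm (c *\<^sub>R u) / \<bar>c\<bar> \<le> (\<Sum>(x, y)\<leftarrow>xs. norm x * norm y)"
      using projective_norm_le[of ?ys] False u by (simp add: field_simps)
  qed
  then show ?thesis using False by (simp add: field_simps)
qed

lemma ex_separating_functional:
  fixes S :: "'a::real_normed_vector set"
  assumes "finite S" "x \<notin> span S"
  shows "\<exists>f :: 'a \<Rightarrow>\<^sub>L real. blinfun_apply f x = 1 \<and> (\<forall>s\<in>S. blinfun_apply f s = 0)"
  using assms
proof (induction S arbitrary: x rule: finite_induct)
  case empty
  then have "x \<noteq> 0" by auto
  obtain f :: "'a \<Rightarrow>\<^sub>L real" where "blinfun_apply f x = norm x"
    using ex_norming_functional by blast
  then show ?case
    using \<open>x \<noteq> 0\<close> by (intro exI[of _ "inverse (norm x) *\<^sub>R f"]) (simp add: scaleR_blinfun.rep_eq)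
next
  case (insert a S)
  show ?case
  proof (cases "a \<in> span S")
    case True
    then have "x \<notin> span S" using insert.prems by (simp add: span_redundant)
    then obtain f :: "'a \<Rightarrow>\<^sub>L real" where f: "blinfun_apply f x = 1" "\<forall>s\<in>S. blinfun_apply f s = 0"
      using insert.IH by blast
    have "blinfun_apply f a = 0"
      using True f(2) linear_eq_0_on_span[OF bounded_linear.linear[OF blinfun.bounded_linear_right], of S f a]
      by blast
    then show ?thesis using f by auto
  next
    case False
    then obtain g :: "'a \<Rightarrow>\<^sub>L real" where g: "blinfun_apply g a = 1" "\<forall>s\<in>S. blinfun_apply g s = 0"
      using insert.IH by blast
    have "x - blinfun_apply g x *\<^sub>R a \<notin> span S"
      using insert.prems by (auto simp: span_breakdown_eq)
    then obtain f :: "'a \<Rightarrow>\<^sub>L real" where f: "blinfun_apply f (x - blinfun_apply g x *\<^sub>R a) = 1"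
      "\<forall>s\<in>S. blinfun_apply f s = 0"
      using insert.IH by blast
    show ?thesis
      using f g by (intro exI[of _ "f - blinfun_apply f a *\<^sub>R g"])
        (auto simp: minus_blinfun.rep_eq scaleR_blinfun.rep_eq blinfun.diff_right blinfun.scaleR_right mult.commute)
  qed
qed

lemma sum_list_tensor_absorb:
  fixes ys :: "('a::real_vector \<times> 'b::real_vector) list"
  assumes "x \<in> span (fst ` set ys)"
  shows "\<exists>zs. length zs = length ys \<and>
    (\<Sum>(x, y)\<leftarrow>zs. tensor_elem x y) = tensor_elem x y + (\<Sum>(x, y)\<leftarrow>ys. tensor_elem x y)"
  using assms
proof (induction ys arbitrary: x)
  case Nil
  then show ?case by (simp add: bilinear_lzero[OF bilinear_tensor_elem])
next
  case (Cons p ys)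
  obtain a b where p: "p = (a, b)" by (cases p)
  obtain k where k: "x - k *\<^sub>R a \<in> span (fst ` set ys)"
    using Cons.prems by (auto simp: p span_breakdown_eq)
  obtain zs where zs: "length zs = length ys" "(\<Sum>(x, y)\<leftarrow>zs. tensor_elem x y) =
      tensor_elem (x - k *\<^sub>R a) y + (\<Sum>(x, y)\<leftarrow>ys. tensor_elem x y)"
    using Cons.IH[OF k] by blast
  then show ?case
    by (intro exI[of _ "(a, b + k *\<^sub>R y) # zs"])
      (simp add: p bilinear_radd[OF bilinear_tensor_elem] bilinear_rmul[OF bilinear_tensor_elem]
        bilinear_lsub[OF bilinear_tensor_elem] bilinear_lmul[OF bilinear_tensor_elem] algebra_simps)
qed

lemma tensor_functionals_separate:
  fixes u :: "('a::real_normed_vector, 'b::real_normed_vector) tensor"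
  assumes "\<And>(f :: 'a \<Rightarrow>\<^sub>L real) (g :: 'b \<Rightarrow>\<^sub>L real) L. linear L \<Longrightarrow>
      (\<And>x y. L (tensor_elem x y) = blinfun_apply f x * blinfun_apply g y) \<Longrightarrow> L u = (0::real)"
  shows "u = 0"
proof -
  have bil: "bilinear (\<lambda>x y. blinfun_apply f x * blinfun_apply g y)"
    for f :: "'a \<Rightarrow>\<^sub>L real" and g :: "'b \<Rightarrow>\<^sub>L real"
    unfolding bilinear_def
    by (auto intro!: linearI simp: blinfun.add_right blinfun.scaleR_right algebra_simps)
  obtain L where lin: "\<And>(f :: 'a \<Rightarrow>\<^sub>L real) (g :: 'b \<Rightarrow>\<^sub>L real). linear (L f g)"
    and L_elem: "\<And>f g x y. L f g (tensor_elem x y) = blinfun_apply f x * blinfun_apply g y"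
    using tensor_universal[OF bil] by metis
  have L_sum: "L f g (\<Sum>(x, y)\<leftarrow>xs. tensor_elem x y)
      = (\<Sum>(x, y)\<leftarrow>xs. blinfun_apply f x * blinfun_apply g y)" for f g xs
    by (induction xs) (auto simp: linear_0[OF lin] linear_add[OF lin] L_elem)
  have "(\<Sum>(x, y)\<leftarrow>xs. tensor_elem x y) = (0 :: ('a, 'b) tensor)"
    if "\<And>f g. L f g (\<Sum>(x, y)\<leftarrow>xs. tensor_elem x y) = 0" for xs
    using that
  proof (induction xs rule: length_induct)
    case (1 xs)
    show ?case
    proof (cases xs)
      case (Cons p ys)
      obtain x y where p: "p = (x, y)" by (cases p)
      show ?thesis
      proof (cases "x \<in> span (fst ` set ys)")
        case True
        then obtain zs where zs: "length zs = length ys" "(\<Sum>(x, y)\<leftarrow>zs. tensor_elem x y) =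
            tensor_elem x y + (\<Sum>(x, y)\<leftarrow>ys. tensor_elem x y)"
          using sum_list_tensor_absorb by blast
        then have eq: "(\<Sum>(x, y)\<leftarrow>zs. tensor_elem x y) = (\<Sum>(x, y)\<leftarrow>xs. tensor_elem x y)"
          by (simp add: Cons p)
        show ?thesis
          using "1.IH"[rule_format, of zs] "1.prems" zs(1) unfolding eq by (simp add: Cons)
      next
        case False
        then obtain f :: "'a \<Rightarrow>\<^sub>L real" where f: "blinfun_apply f x = 1"
          "\<forall>s\<in>fst ` set ys. blinfun_apply f s = 0"
          using ex_separating_functional[of "fst ` set ys" x] by auto
        have "(\<Sum>(x, y)\<leftarrow>ys. blinfun_apply f x * blinfun_apply g y) = 0" for g :: "'b \<Rightarrow>\<^sub>L real"
          using f(2) by (induction ys) auto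
        then have "blinfun_apply g y = 0" for g :: "'b \<Rightarrow>\<^sub>L real"
          using "1.prems"[of f g] unfolding L_sum by (simp add: Cons p f)
        then have "y = 0"
          using ex_norming_functional[of y] by auto
        then have eq: "(\<Sum>(x, y)\<leftarrow>xs. tensor_elem x y) = (\<Sum>(x, y)\<leftarrow>ys. tensor_elem x y)"
          by (simp add: Cons p bilinear_rzero[OF bilinear_tensor_elem])
        show ?thesis
          using "1.IH"[rule_format, of ys] "1.prems" unfolding eq by (simp add: Cons)
      qed
    qed simp
  qed
  moreover obtain xs where "u = (\<Sum>(x, y)\<leftarrow>xs. tensor_elem x y)"
    using tensor_eq_sum_list by blast
  moreover have "L f g u = 0" for f g
    by (rule assms[OF lin L_elem])
  ultimately show ?thesis by blast
qed

lemma projective_norm_eq_0_imp: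
  fixes u :: "('a::real_normed_vector, 'b::real_normed_vector) tensor"
  assumes "projective_norm u = 0"
  shows "u = 0"
proof (rule tensor_functionals_separate)
  fix f :: "'a \<Rightarrow>\<^sub>L real" and g :: "'b \<Rightarrow>\<^sub>L real" and L
  assume lin: "linear L" and L: "\<And>x y. L (tensor_elem x y) = blinfun_apply f x * blinfun_apply g y"
  let ?K = "norm f * norm g + 1"
  have K: "0 < ?K" by (simp add: add_nonneg_pos)
  have "\<bar>L u\<bar> / ?K \<le> projective_norm u"
  proof (rule projective_norm_ge)
    fix xs :: "('a \<times> 'b) list"
    assume u: "u = (\<Sum>(x, y)\<leftarrow>xs. tensor_elem x y)"
    have "\<bar>L (\<Sum>(x, y)\<leftarrow>xs. tensor_elem x y)\<bar> \<le> ?K * (\<Sum>(x, y)\<leftarrow>xs. norm x * norm y)"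
    proof (induction xs)
      case (Cons p xs)
      obtain x y where p: "p = (x, y)" by (cases p)
      have "\<bar>blinfun_apply f x * blinfun_apply g y\<bar> \<le> (norm f * norm x) * (norm g * norm y)"
        using norm_blinfun[of f x] norm_blinfun[of g y] unfolding abs_mult
        by (intro mult_mono) auto
      also have "\<dots> \<le> ?K * (norm x * norm y)"
        by (simp add: algebra_simps)
      finally show ?case
        using Cons by (simp add: p linear_add[OF lin] L algebra_simps)
    qed (simp add: linear_0[OF lin])
    then show "\<bar>L u\<bar> / ?K \<le> (\<Sum>(x, y)\<leftarrow>xs. norm x * norm y)"
      using K u by (simp add: divide_le_eq mult.commute)
  qed
  then show "L u = 0" using assms K by (simp add: divide_le_0_iff)
qed

instantiation tensor :: (real_normed_vector, real_normed_vector) real_normed_vector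
begin

definition norm_tensor :: "('a, 'b) tensor \<Rightarrow> real" where
  "norm_tensor = projective_norm"
definition dist_tensor :: "('a, 'b) tensor \<Rightarrow> ('a, 'b) tensor \<Rightarrow> real" where
  "dist_tensor u v = norm (u - v)"
definition sgn_tensor :: "('a, 'b) tensor \<Rightarrow> ('a, 'b) tensor" where
  "sgn_tensor u = inverse (norm u) *\<^sub>R u"
definition uniformity_tensor :: "(('a, 'b) tensor \<times> ('a, 'b) tensor) filter" where
  "uniformity_tensor = (INF e\<in>{0<..}. principal {(u, v). dist u v < e})"
definition open_tensor :: "('a, 'b) tensor set \<Rightarrow> bool" where
  "open_tensor U \<longleftrightarrow> (\<forall>u\<in>U. eventually (\<lambda>(u', v). u' = u \<longrightarrow> v \<in> U) uniformity)"

instance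
proof
  fix u v :: "('a, 'b) tensor" and c :: real
  show "norm u = 0 \<longleftrightarrow> u = 0"
    using projective_norm_eq_0_imp[of u] projective_norm_le[of "[] :: ('a \<times> 'b) list"]
      projective_norm_nonneg[of u]
    by (auto simp: norm_tensor_def)
  show "norm (u + v) \<le> norm u + norm v"
    unfolding norm_tensor_def by (rule projective_norm_add)
  show "norm (c *\<^sub>R u) = \<bar>c\<bar> * norm u"
  proof (cases "c = 0")
    case True
    then show ?thesis
      using projective_norm_scale_le[of 0 u] projective_norm_nonneg[of "0 *\<^sub>R u"]
      by (simp add: norm_tensor_def)
  next
    case False
    then show ?thesis
      using projective_norm_scale_le[of c u] projective_norm_scale_le[of "inverse c" "c *\<^sub>R u"]
      by (simp add: norm_tensor_def field_simps abs_if split: if_splits)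
  qed
qed (simp_all add: dist_tensor_def sgn_tensor_def uniformity_tensor_def open_tensor_def)

end

type_synonym ('a, 'b) projective_tensor = "('a, 'b) tensor completion"

definition ptensor_elem ::
    "'a::real_normed_vector \<Rightarrow> 'b::real_normed_vector \<Rightarrow> ('a, 'b) projective_tensor"
    (infixr \<open>\<otimes>\<close> 70) where
  "x \<otimes> y = to_completion (tensor_elem x y)"


section \<open>Induced operators and the quotient space\<close>

text \<open>
  The operators singled out by the next three definitions are determined by the stated values
  because they are continuous and the elements \<open>u \<otimes> v\<close>, respectively \<open>delta x\<close>, span a dense
  subspace.
\<close>

definition ptensor_map ::
    "('a::real_normed_vector \<Rightarrow>\<^sub>L 'c::real_normed_vector) \<Rightarrow>
     ('b::real_normed_vector \<Rightarrow>\<^sub>L 'd::real_normed_vector) \<Rightarrow>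
     ('a, 'b) projective_tensor \<Rightarrow>\<^sub>L ('c, 'd) projective_tensor" where
  "ptensor_map A B = (THE T. \<forall>u v. blinfun_apply T (u \<otimes> v) = blinfun_apply A u \<otimes> blinfun_apply B v)"

definition barycentre :: "'a::banach lip_free \<Rightarrow>\<^sub>L 'a" where
  "barycentre = (THE \<beta>. \<forall>x. blinfun_apply \<beta> (delta x) = x)"

definition lip_free_shift :: "'a::real_normed_vector \<Rightarrow> 'a lip_free \<Rightarrow>\<^sub>L 'a lip_free" where
  "lip_free_shift a = (THE S. \<forall>x. blinfun_apply S (delta x) = delta (x + a) - delta a)"

type_synonym ('a, 'b) free_tensor = "('a lip_free, 'b lip_free) projective_tensor"

definition Q_op :: "('a::banach, 'b::banach) free_tensor \<Rightarrow>\<^sub>L ('a, 'b) projective_tensor" where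
  "Q_op = ptensor_map barycentre barycentre"

definition shift_op ::
    "'a::real_normed_vector \<Rightarrow> 'b::real_normed_vector \<Rightarrow> ('a, 'b) free_tensor \<Rightarrow>\<^sub>L ('a, 'b) free_tensor" where
  "shift_op a b = ptensor_map (lip_free_shift a) (lip_free_shift b)"

definition Z_space :: "('a::real_normed_vector, 'b::real_normed_vector) free_tensor set" where
  "Z_space = closure (span {blinfun_apply (shift_op a b) u - u | a b u. True})"

lemma subspace_Z_space: "subspace Z_space"
  unfolding Z_space_def by (intro subspace_closure subspace_span)

lemma closed_Z_space: "closed Z_space"
  unfolding Z_space_def by (rule closed_closure)

text \<open>Without this, lifting would unfold \<open>free_tensor\<close> down to its raw representation.\<close>

lifting_forget completion.lifting
lifting_forget lip_free.lifting
lifting_forget tensor.lifting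

quotient_type (overloaded) ('a, 'b) Z_quotient =
    "('a::real_normed_vector, 'b::real_normed_vector) free_tensor" / "\<lambda>u v. u - v \<in> Z_space"
  by (rule subspace_cong_equivp[OF subspace_Z_space])

lift_definition Z_coset ::
    "('a::real_normed_vector, 'b::real_normed_vector) free_tensor \<Rightarrow> ('a, 'b) Z_quotient"
  is "\<lambda>u. u" .

lemma Z_coset_eq_iff: "Z_coset u = Z_coset v \<longleftrightarrow> u - v \<in> Z_space"
  by transfer rule

lemma Z_coset_surj: "\<exists>u. w = Z_coset u"
  by transfer (metis subspace_0[OF subspace_Z_space] diff_self)

instantiation Z_quotient :: (real_normed_vector, real_normed_vector) real_vector
begin

lift_definition zero_Z_quotient :: "('a, 'b) Z_quotient" is 0 .
lift_definition plus_Z_quotient ::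
    "('a, 'b) Z_quotient \<Rightarrow> ('a, 'b) Z_quotient \<Rightarrow> ('a, 'b) Z_quotient" is "(+)"
  by (rule subspace_cong_add[OF subspace_Z_space])
lift_definition minus_Z_quotient ::
    "('a, 'b) Z_quotient \<Rightarrow> ('a, 'b) Z_quotient \<Rightarrow> ('a, 'b) Z_quotient" is "(-)"
  by (rule subspace_cong_diff[OF subspace_Z_space])
lift_definition uminus_Z_quotient :: "('a, 'b) Z_quotient \<Rightarrow> ('a, 'b) Z_quotient" is uminus
  by (rule subspace_cong_minus[OF subspace_Z_space])
lift_definition scaleR_Z_quotient :: "real \<Rightarrow> ('a, 'b) Z_quotient \<Rightarrow> ('a, 'b) Z_quotient" is scaleR
  by (rule subspace_cong_scale[OF subspace_Z_space])

instance
  by standard (transfer; simp add: algebra_simps subspace_0[OF subspace_Z_space])+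

end

lemma linear_Z_coset: "linear Z_coset"
  by (rule linearI; transfer) (simp_all add: subspace_0[OF subspace_Z_space])

definition quotient_norm :: "('a::real_normed_vector, 'b::real_normed_vector) Z_quotient \<Rightarrow> real" where
  "quotient_norm w = Inf {norm u | u. Z_coset u = w}"

lemma quotient_norm_le: "quotient_norm (Z_coset u) \<le> norm u"
  unfolding quotient_norm_def by (intro cInf_lower) (auto intro!: bdd_belowI[of _ 0])

lemma quotient_norm_ge:
  assumes "\<And>u. Z_coset u = w \<Longrightarrow> b \<le> norm u"
  shows "b \<le> quotient_norm w"
  unfolding quotient_norm_def using Z_coset_surj[of w] assms by (intro cInf_greatest) auto

lemma quotient_norm_nonneg: "0 \<le> quotient_norm w"
  by (intro quotient_norm_ge) simp

lemma quotient_norm_add: "quotient_norm (v + w) \<le> quotient_norm v + quotient_norm w"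
proof -
  have *: "quotient_norm (v + w) \<le> norm x + norm y" if "Z_coset x = v" "Z_coset y = w" for x y
    using quotient_norm_le[of "x + y"] norm_triangle_ineq[of x y] that
    by (simp add: linear_add[OF linear_Z_coset])
  have "quotient_norm (v + w) - norm x \<le> quotient_norm w" if "Z_coset x = v" for x
    using *[OF that] by (intro quotient_norm_ge) (simp add: algebra_simps)
  then have "quotient_norm (v + w) - quotient_norm w \<le> quotient_norm v"
    by (intro quotient_norm_ge) (simp add: algebra_simps)
  then show ?thesis by simp
qed

lemma quotient_norm_scale_le: "quotient_norm (c *\<^sub>R w) \<le> \<bar>c\<bar> * quotient_norm w"
proof (cases "c = 0")
  case True
  then show ?thesis
    using quotient_norm_le[of 0] by (simp add: linear_0[OF linear_Z_coset])
next
  case False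
  have "quotient_norm (c *\<^sub>R w) / \<bar>c\<bar> \<le> quotient_norm w"
  proof (rule quotient_norm_ge)
    fix u assume "Z_coset u = w"
    then show "quotient_norm (c *\<^sub>R w) / \<bar>c\<bar> \<le> norm u"
      using quotient_norm_le[of "c *\<^sub>R u"] False
      by (simp add: linear_scale[OF linear_Z_coset] field_simps)
  qed
  then show ?thesis using False by (simp add: field_simps)
qed

lemma quotient_norm_eq_0_imp:
  assumes "quotient_norm w = 0"
  shows "w = 0"
proof -
  obtain u where u: "w = Z_coset u" using Z_coset_surj by blast
  have "u \<in> closure Z_space"
    unfolding closure_approachable
  proof (intro allI impI)
    fix e :: real assume "0 < e"
    then obtain v where v: "Z_coset v = w" "norm v < e"
      using quotient_norm_ge[of w e] assms by (metis not_le)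
    then have "u - v \<in> Z_space" using u by (simp add: Z_coset_eq_iff[symmetric])
    moreover have "dist (u - v) u < e" using v by (simp add: dist_norm)
    ultimately show "\<exists>y\<in>Z_space. dist y u < e" by blast
  qed
  then have "Z_coset u = Z_coset 0"
    by (simp add: Z_coset_eq_iff closure_closed[OF closed_Z_space])
  then show ?thesis by (simp add: u linear_0[OF linear_Z_coset])
qed

instantiation Z_quotient :: (real_normed_vector, real_normed_vector) real_normed_vector
begin

definition norm_Z_quotient :: "('a, 'b) Z_quotient \<Rightarrow> real" where
  "norm_Z_quotient = quotient_norm"
definition dist_Z_quotient :: "('a, 'b) Z_quotient \<Rightarrow> ('a, 'b) Z_quotient \<Rightarrow> real" where
  "dist_Z_quotient u v = norm (u - v)"
definition sgn_Z_quotient :: "('a, 'b) Z_quotient \<Rightarrow> ('a, 'b) Z_quotient" where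
  "sgn_Z_quotient u = inverse (norm u) *\<^sub>R u"
definition uniformity_Z_quotient :: "(('a, 'b) Z_quotient \<times> ('a, 'b) Z_quotient) filter" where
  "uniformity_Z_quotient = (INF e\<in>{0<..}. principal {(u, v). dist u v < e})"
definition open_Z_quotient :: "('a, 'b) Z_quotient set \<Rightarrow> bool" where
  "open_Z_quotient U \<longleftrightarrow> (\<forall>u\<in>U. eventually (\<lambda>(u', v). u' = u \<longrightarrow> v \<in> U) uniformity)"

instance
proof
  fix v w :: "('a, 'b) Z_quotient" and c :: real
  have zero: "quotient_norm (0 :: ('a, 'b) Z_quotient) = 0"
    using quotient_norm_le[of "0 :: ('a, 'b) free_tensor"] quotient_norm_nonneg[of "0 :: ('a, 'b) Z_quotient"]
    by (simp add: linear_0[OF linear_Z_coset])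
  show "norm v = 0 \<longleftrightarrow> v = 0"
    using quotient_norm_eq_0_imp[of v] zero by (auto simp: norm_Z_quotient_def)
  show "norm (v + w) \<le> norm v + norm w"
    unfolding norm_Z_quotient_def by (rule quotient_norm_add)
  show "norm (c *\<^sub>R v) = \<bar>c\<bar> * norm v"
  proof (cases "c = 0")
    case True
    then show ?thesis by (simp add: norm_Z_quotient_def zero)
  next
    case False
    then show ?thesis
      using quotient_norm_scale_le[of c v] quotient_norm_scale_le[of "inverse c" "c *\<^sub>R v"]
      by (simp add: norm_Z_quotient_def field_simps abs_if split: if_splits)
  qed
qed (simp_all add: dist_Z_quotient_def sgn_Z_quotient_def uniformity_Z_quotient_def open_Z_quotient_def)

end

end

theory Submission
  imports Defs
begin

text \<open>
  The point is that, modulo \<open>Z_space\<close>, the tensor \<open>delta x \<otimes> delta y\<close> is bilinear in \<open>(x, y)\<close>.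
  Since \<open>lip_free_shift 0\<close> is the identity, the pair \<open>(a, 0)\<close> shifts the first factor alone,
  and it puts \<open>(delta (x + a) - delta a - delta x) \<otimes> delta y\<close> into \<open>Z_space\<close>; so the coset of
  \<open>delta x \<otimes> delta y\<close> is additive in \<open>x\<close>, and by symmetry in \<open>y\<close>. Its norm is at most
  \<open>norm x * norm y\<close>, and an additive map with a linear bound is homogeneous over the reals
  (\<open>linear_if_additive_bounded\<close>). The universal property of the tensor product therefore gives a
  linear contraction \<open>T\<close> from the algebraic tensor product of \<open>X\<close> and \<open>Y\<close> into the quotient
  with \<open>T (tensor_elem x y) = Z_coset (delta x \<otimes> delta y)\<close>.

  This \<open>T\<close> undoes \<open>Q_op\<close>: a linear combination \<open>u\<close> of the tensors \<open>delta x \<otimes> delta y\<close> has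
  \<open>Q_op u\<close> in the algebraic tensor product, and \<open>T\<close> sends it to the coset of \<open>u\<close>. Hence
  \<open>norm (Z_coset u) \<le> norm (Q_op u)\<close> for these \<open>u\<close>, and by density for all \<open>u\<close>
  (\<open>norm_Z_coset_le_norm_Q_op\<close>). Arguing with this inequality on a dense set avoids extending \<open>T\<close>
  to the completion, which would need completeness of the quotient. The inequality gives both
  the inclusion of the kernel in \<open>Z_space\<close> and the lower bound for the norm of the induced
  operator. The opposite inclusion holds because the barycentre of \<open>delta (x + a) - delta a\<close> is
  \<open>x\<close>, so that \<open>Q_op\<close> is invariant under all shifts, and the upper bound holds because \<open>Q_op\<close> is
  a contraction.

  For surjectivity, a representation of a tensor over \<open>X\<close> and \<open>Y\<close> by elementary tensors of total
  cost at most twice its norm lifts term by term, at no greater cost, to a sum of tensors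
  \<open>delta x \<otimes> delta y\<close>; a telescoping series extends such bounded lifts from a dense subspace to
  the completion (\<open>surj_if_bounded_lift_on_dense\<close>).

  The operators in the statement are defined by descriptions, so each of them also has to be
  shown to exist. This is what \<open>lip_free_universal\<close> and \<open>ptensor_map_props\<close> are for; uniqueness
  is always density.
\<close>


section \<open>Extension of bounded linear maps from dense subspaces\<close>

text \<open>
  The dense subspace is presented as the range of a linear map \<open>j\<close>, and the bound by
  \<open>norm (j v)\<close> makes \<open>L\<close> factor through \<open>j\<close>. In this form the lemma serves both a
  completion, with \<open>j\<close> the embedding, and the Lipschitz-free space, with \<open>j\<close> defined on formal
  linear combinations of points.
\<close>

lemma ex_blinfun_extension:
  fixes j :: "'v::real_vector \<Rightarrow> 'e::real_normed_vector" and L :: "'v \<Rightarrow> 'g::banach"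
  assumes j: "linear j" and L: "linear L"
    and bound: "\<And>v. norm (L v) \<le> K * norm (j v)" and K: "0 \<le> K"
    and dense: "closure (range j) = UNIV"
  shows "\<exists>T :: 'e \<Rightarrow>\<^sub>L 'g. norm T \<le> K \<and> (\<forall>v. blinfun_apply T (j v) = L v)"
proof -
  have "\<exists>s. (\<lambda>n. j (s n)) \<longlonglongrightarrow> e" for e
  proof -
    have "e \<in> closure (range j)" using dense by simp
    then obtain f where f: "\<And>n. f n \<in> range j" "f \<longlonglongrightarrow> e"
      unfolding closure_sequential by blast
    from f(1) have "\<forall>n. \<exists>v. f n = j v" by blast
    then obtain s where "\<And>n. f n = j (s n)" by metis
    then have "f = (\<lambda>n. j (s n))" by (rule ext)
    then show ?thesis using f(2) by blast
  qed
  then obtain s where s: "\<And>e. (\<lambda>n. j (s e n)) \<longlonglongrightarrow> e" by metis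
  have "convergent (\<lambda>n. L (s e n))" for e
  proof -
    have C: "Cauchy (\<lambda>n. j (s e n))" using s LIMSEQ_imp_Cauchy by blast
    have d: "dist (L a) (L b) \<le> K * dist (j a) (j b)" for a b
      using bound[of "a - b"] by (simp add: dist_norm linear_diff[OF L] linear_diff[OF j])
    have "Cauchy (\<lambda>n. L (s e n))"
    proof (rule metric_CauchyI)
      fix r :: real assume r: "0 < r"
      \<comment> \<open>Dividing by \<open>K + 1\<close> covers the case \<open>K = 0\<close>.\<close>
      obtain M where M: "\<And>m n. m \<ge> M \<Longrightarrow> n \<ge> M \<Longrightarrow> dist (j (s e m)) (j (s e n)) < r / (K + 1)"
        using metric_CauchyD[OF C, of "r / (K + 1)"] r K by (metis divide_pos_pos add_nonneg_pos zero_less_one)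
      have "dist (L (s e m)) (L (s e n)) < r" if "m \<ge> M" "n \<ge> M" for m n
      proof -
        have "dist (L (s e m)) (L (s e n)) \<le> (K + 1) * dist (j (s e m)) (j (s e n))"
          using d[of "s e m" "s e n"] zero_le_dist[of "j (s e m)" "j (s e n)"]
          by (simp add: algebra_simps del: zero_le_dist)
        also have "\<dots> < r" using M[OF that] K by (simp add: field_simps)
        finally show ?thesis .
      qed
      then show "\<exists>M. \<forall>m\<ge>M. \<forall>n\<ge>M. dist (L (s e m)) (L (s e n)) < r" by blast
    qed
    then show ?thesis by (rule Cauchy_convergent)
  qed
  then obtain T where T: "\<And>e. (\<lambda>n. L (s e n)) \<longlonglongrightarrow> T e"
    unfolding convergent_def by metis
  \<comment> \<open>The value does not depend on the approximating sequence; linearity and the bound follow.\<close>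
  have T_lim: "(\<lambda>n. L (t n)) \<longlonglongrightarrow> T e" if t: "(\<lambda>n. j (t n)) \<longlonglongrightarrow> e" for t e
  proof -
    have "(\<lambda>n. K * norm (j (t n) - j (s e n))) \<longlonglongrightarrow> K * norm (e - e)"
      by (intro tendsto_intros t s)
    then have "(\<lambda>n. K * norm (j (t n) - j (s e n))) \<longlonglongrightarrow> 0" by simp
    then have "(\<lambda>n. L (t n) - L (s e n)) \<longlonglongrightarrow> 0"
    proof (rule Lim_null_comparison[rotated], intro always_eventually allI)
      show "norm (L (t n) - L (s e n)) \<le> K * norm (j (t n) - j (s e n))" for n
        using bound[of "t n - s e n"] by (simp add: linear_diff[OF L] linear_diff[OF j])
    qed
    from tendsto_add[OF this T[of e]] show ?thesis by simp
  qed
  have T_j: "T (j v) = L v" for v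
    using T_lim[of "\<lambda>_. v" "j v"] LIMSEQ_unique[of "\<lambda>_. L v"] by simp
  have T_add: "T (x + y) = T x + T y" for x y
  proof -
    have "(\<lambda>n. j (s x n + s y n)) \<longlonglongrightarrow> x + y"
      unfolding linear_add[OF j] by (intro tendsto_intros s)
    from T_lim[OF this] have "(\<lambda>n. L (s x n) + L (s y n)) \<longlonglongrightarrow> T (x + y)"
      by (simp add: linear_add[OF L])
    then show ?thesis using tendsto_add[OF T T] LIMSEQ_unique by blast
  qed
  have T_scale: "T (c *\<^sub>R x) = c *\<^sub>R T x" for c x
  proof -
    have "(\<lambda>n. j (c *\<^sub>R s x n)) \<longlonglongrightarrow> c *\<^sub>R x"
      unfolding linear_scale[OF j] by (intro tendsto_intros s)
    from T_lim[OF this] have "(\<lambda>n. c *\<^sub>R L (s x n)) \<longlonglongrightarrow> T (c *\<^sub>R x)"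
      by (simp add: linear_scale[OF L])
    then show ?thesis using tendsto_scaleR[OF tendsto_const T] LIMSEQ_unique by blast
  qed
  have T_bound: "norm (T x) \<le> K * norm x" for x
  proof (rule tendsto_le[OF sequentially_bot])
    show "(\<lambda>n. K * norm (j (s x n))) \<longlonglongrightarrow> K * norm x" by (intro tendsto_intros s)
    show "(\<lambda>n. norm (L (s x n))) \<longlonglongrightarrow> norm (T x)" by (intro tendsto_intros T)
  qed (simp add: bound)
  have "bounded_linear T"
    using T_add T_scale T_bound by (intro bounded_linear_intro[where K = K]) (auto simp: mult.commute)
  then have app: "blinfun_apply (Blinfun T) = T" by (rule bounded_linear_Blinfun_apply)
  have "norm (Blinfun T) \<le> K"
    using K T_bound by (intro norm_blinfun_bound) (auto simp: app)
  then show ?thesis using T_j app by (intro exI[of _ "Blinfun T"]) simp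
qed

lemma dense_span_subset:
  fixes S :: "'a::real_normed_vector set"
  assumes "closure (span S) = UNIV" "subspace M" "closed M" "S \<subseteq> M"
  shows "M = UNIV"
  using assms closure_minimal[of "span S" M] span_minimal[of S M] by blast

lemma subspace_vimage_blinfun:
  assumes "subspace M"
  shows "subspace {u. blinfun_apply T u \<in> M}"
  using linear_subspace_vimage[OF bounded_linear.linear[OF blinfun.bounded_linear_right] assms, of T]
  by (simp add: vimage_def)

lemma blinfun_eq_if_eq_on_dense:
  fixes T U :: "'a::real_normed_vector \<Rightarrow>\<^sub>L 'b::real_normed_vector"
  assumes dense: "closure (span S) = UNIV"
    and eq: "\<And>x. x \<in> S \<Longrightarrow> blinfun_apply T x = blinfun_apply U x"
  shows "T = U"
proof -
  have "{x. blinfun_apply (T - U) x \<in> {0}} = UNIV"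
  proof (rule dense_span_subset[OF dense])
    show "subspace {x. blinfun_apply (T - U) x \<in> {0}}"
      by (rule subspace_vimage_blinfun) (rule subspace_single_0)
    show "closed {x. blinfun_apply (T - U) x \<in> {0}}"
      by (simp, intro closed_Collect_eq continuous_intros)
  qed (auto simp: minus_blinfun.rep_eq eq)
  then show ?thesis
    by (auto simp: set_eq_iff minus_blinfun.rep_eq intro: blinfun_eqI)
qed

lemma the_blinfun_eqI:
  fixes T :: "'a::real_normed_vector \<Rightarrow>\<^sub>L 'b::real_normed_vector"
  assumes dense: "closure (span S) = UNIV" and P: "P T"
    and val: "\<And>U x. P U \<Longrightarrow> x \<in> S \<Longrightarrow> blinfun_apply U x = g x"
  shows "(THE T. P T) = T"
  using P by (rule the_equality) (rule blinfun_eq_if_eq_on_dense[OF dense], simp add: val P)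

text \<open>
  Approximate a target \<open>t\<close> geometrically fast by elements of \<open>D\<close>; the lifts of their successive
  differences form an absolutely convergent series, and its sum lifts \<open>t\<close> up to the first
  approximation.
\<close>

lemma surj_if_bounded_lift_on_dense:
  fixes T :: "'a::banach \<Rightarrow>\<^sub>L 'b::real_normed_vector"
  assumes D: "subspace D" and dense: "closure D = UNIV"
    and lift: "\<And>t. t \<in> D \<Longrightarrow> \<exists>v. blinfun_apply T v = t \<and> norm v \<le> K * norm t"
  shows "surj (blinfun_apply T)"
proof -
  have "\<exists>u. t = blinfun_apply T u" for t
  proof -
    have "\<exists>d\<in>D. dist d t < (1/2) ^ n" for n
      using dense closure_approachable[of t D] by simp
    then obtain d where d: "\<And>n. d n \<in> D" "\<And>n. dist (d n) t < (1/2) ^ n" by metis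
    have "\<exists>v. blinfun_apply T v = d (Suc n) - d n \<and> norm v \<le> K * norm (d (Suc n) - d n)" for n
      by (intro lift subspace_diff[OF D] d)
    then obtain v where v: "\<And>n. blinfun_apply T (v n) = d (Suc n) - d n"
      "\<And>n. norm (v n) \<le> K * norm (d (Suc n) - d n)" by metis
    obtain v0 where v0: "blinfun_apply T v0 = d 0" using lift d(1) by blast
    have bd: "norm (v n) \<le> \<bar>K\<bar> * 2 * (1/2) ^ n" for n
    proof -
      have "norm (d (Suc n) - d n) \<le> dist (d (Suc n)) t + dist (d n) t"
        by (metis dist_norm dist_triangle2)
      also have "\<dots> \<le> 2 * (1/2) ^ n" using d(2)[of n] d(2)[of "Suc n"] zero_le_dist[of "d (Suc n)" t]
        unfolding power_Suc by linarith
      finally have "\<bar>K\<bar> * norm (d (Suc n) - d n) \<le> \<bar>K\<bar> * (2 * (1/2) ^ n)"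
        by (intro mult_left_mono) auto
      moreover have "K * norm (d (Suc n) - d n) \<le> \<bar>K\<bar> * norm (d (Suc n) - d n)"
        by (intro mult_right_mono) auto
      ultimately show ?thesis using v(2)[of n] by simp
    qed
    have "summable (\<lambda>n. \<bar>K\<bar> * 2 * (1/2::real) ^ n)"
      by (intro summable_mult summable_geometric) simp
    then have "summable v" using bd by (rule summable_comparison_test')
    then have "(\<lambda>n. \<Sum>k<n. v k) \<longlonglongrightarrow> suminf v" by (rule summable_LIMSEQ)
    then have "(\<lambda>n. blinfun_apply T (\<Sum>k<n. v k)) \<longlonglongrightarrow> blinfun_apply T (suminf v)"
      by (intro tendsto_intros)
    moreover have "blinfun_apply T (\<Sum>k<n. v k) = d n - d 0" for n
      by (simp add: blinfun.sum_right v sum_lessThan_telescope)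
    ultimately have "(\<lambda>n. d n - d 0) \<longlonglongrightarrow> blinfun_apply T (suminf v)" by simp
    moreover have "d \<longlonglongrightarrow> t"
    proof (rule metric_tendsto_imp_tendsto[of "\<lambda>n. (1/2::real) ^ n" 0])
      show "(\<lambda>n. (1/2::real) ^ n) \<longlonglongrightarrow> 0" by (intro LIMSEQ_realpow_zero) auto
      show "\<forall>\<^sub>F n in sequentially. dist (d n) t \<le> dist ((1/2::real) ^ n) 0"
        using d(2) by (intro always_eventually) (auto intro: less_imp_le)
    qed
    ultimately have "blinfun_apply T (suminf v) = t - d 0"
      using LIMSEQ_unique tendsto_diff[OF \<open>d \<longlonglongrightarrow> t\<close> tendsto_const] by blast
    then have "t = blinfun_apply T (suminf v + v0)" by (simp add: blinfun.add_right v0)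
    then show ?thesis ..
  qed
  then show ?thesis by (auto simp: surj_def)
qed

text \<open>
  For fixed \<open>x\<close>, the deviation \<open>h r = f (r *\<^sub>R x) - r *\<^sub>R f x\<close> is additive in \<open>r\<close> and vanishes at
  the integers. So it only depends on the fractional part of \<open>r\<close> and is bounded; a bounded
  additive function is zero, because \<open>h (n * r) = n *\<^sub>R h r\<close>.
\<close>

lemma linear_if_additive_bounded:
  fixes f :: "'a::real_normed_vector \<Rightarrow> 'b::real_normed_vector"
  assumes add: "\<And>x y. f (x + y) = f x + f y" and bound: "\<And>x. norm (f x) \<le> K * norm x"
  shows "linear f"
proof (rule linearI[OF add])
  fix r :: real and x
  define h where "h = (\<lambda>r. f (r *\<^sub>R x) - r *\<^sub>R f x)"
  have h_add: "h (r + s) = h r + h s" for r s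
    by (simp add: h_def add scaleR_left_distrib)
  have h_mult: "h (real n * r) = real n *\<^sub>R h r" for n r
    using h_add[of 0 0]
    by (induction n) (auto simp: h_add distrib_right scaleR_left_distrib)
  have h_one: "h 1 = 0" by (simp add: h_def)
  have h_nat: "h (real n) = 0" for n using h_mult[of n 1] h_one by simp
  have h_neg: "h (- r) = - h r" for r
    using h_add[of r "- r"] h_add[of 0 0] by (simp add: eq_neg_iff_add_eq_0 add.commute)
  have h_int: "h (of_int i) = 0" for i
    using h_nat h_neg by (cases i rule: int_cases2) auto
  let ?M = "\<bar>K\<bar> * norm x + norm (f x)"
  have h_bound: "norm (h r) \<le> ?M" for r
  proof -
    have fr: "\<bar>frac r\<bar> \<le> 1" using frac_ge_0[of r] frac_lt_1[of r] by linarith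
    have "h r = h (frac r)"
      using h_add[of "frac r" "of_int \<lfloor>r\<rfloor>"] h_int by (simp add: frac_def)
    also have "norm (h (frac r)) \<le> norm (f (frac r *\<^sub>R x)) + \<bar>frac r\<bar> * norm (f x)"
      unfolding h_def by (rule order_trans[OF norm_triangle_ineq4]) simp
    also have "\<dots> \<le> \<bar>K\<bar> * norm x + norm (f x)"
    proof (intro add_mono)
      have "norm (f (frac r *\<^sub>R x)) \<le> K * (\<bar>frac r\<bar> * norm x)"
        using bound[of "frac r *\<^sub>R x"] by simp
      also have "\<dots> \<le> \<bar>K\<bar> * (1 * norm x)"
        using fr by (intro mult_mono mult_right_mono) auto
      finally show "norm (f (frac r *\<^sub>R x)) \<le> \<bar>K\<bar> * norm x" by simp
      show "\<bar>frac r\<bar> * norm (f x) \<le> norm (f x)"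
        using mult_right_mono[OF fr, of "norm (f x)"] by simp
    qed
    finally show ?thesis .
  qed
  have "norm (h r) = 0"
  proof (rule ccontr)
    assume "norm (h r) \<noteq> 0"
    then obtain n where "?M < real n * norm (h r)"
      using reals_Archimedean3[of "norm (h r)"] by auto
    then show False using h_bound[of "real n * r"] by (simp add: h_mult)
  qed
  then show "f (r *\<^sub>R x) = r *\<^sub>R f x" by (simp add: h_def)
qed


section \<open>The universal property of the Lipschitz-free space\<close>

lemma lip_free_apply_delta:
  "blinfun_apply (Rep_lip_free (delta x)) f = lip0_apply f x"
  by (simp add: delta.rep_eq eval_functional.rep_eq)

lemma linear_Rep_lip_free: "linear Rep_lip_free"
  by (rule linearI) (simp_all add: plus_lip_free.rep_eq scaleR_lip_free.rep_eq)

lemma dense_span_delta: "closure (span (range delta)) = (UNIV :: 'a::real_normed_vector lip_free set)"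
proof -
  have img: "Rep_lip_free ` span (range (delta :: 'a \<Rightarrow> _)) = span (range eval_functional)"
    unfolding linear_span_image[OF linear_Rep_lip_free, symmetric] image_image delta.rep_eq ..
  have "u \<in> closure (span (range delta))" for u :: "'a lip_free"
    unfolding closure_approachable
  proof (intro allI impI)
    fix e :: real assume "0 < e"
    then obtain w where w: "w \<in> span (range eval_functional)" "dist w (Rep_lip_free u) < e"
      using Rep_lip_free[of u] unfolding closure_approachable by blast
    then obtain d where "d \<in> span (range delta)" "w = Rep_lip_free d"
      unfolding img[symmetric] by blast
    then show "\<exists>y\<in>span (range delta). dist y u < e"
      using w(2) by (auto simp: dist_norm norm_lip_free.rep_eq minus_lip_free.rep_eq)
  qed
  then show ?thesis by auto
qed

lemma norm_lip0_le: "norm f \<le> C" if "C-lipschitz_on UNIV (lip0_apply f)"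
  unfolding norm_lip0_def using that by (rule lip_const_le)

lemma norm_delta_diff_le: "norm (delta x - delta y) \<le> norm (x - y)"
proof -
  have "norm (Rep_lip_free (delta x - delta y)) \<le> norm (x - y)"
  proof (rule norm_blinfun_bound)
    fix f
    have "\<bar>lip0_apply f x - lip0_apply f y\<bar> \<le> norm f * norm (x - y)"
      using lipschitz_onD[OF lipschitz_on_lip_const[of f], of x y]
      by (simp add: norm_lip0_def dist_norm)
    then show "norm (blinfun_apply (Rep_lip_free (delta x - delta y)) f) \<le> norm (x - y) * norm f"
      by (simp add: minus_lip_free.rep_eq minus_blinfun.rep_eq lip_free_apply_delta mult.commute)
  qed simp
  then show ?thesis by (simp add: norm_lip_free.rep_eq)
qed

lemma delta_0 [simp]: "delta 0 = 0"
  by (simp add: Rep_lip_free_inject[symmetric] zero_lip_free.rep_eq)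
    (simp add: blinfun_eqI lip_free_apply_delta)

lemma norm_delta_le: "norm (delta x) \<le> norm x"
  using norm_delta_diff_le[of x 0] by simp

text \<open>
  A Lipschitz map \<open>g\<close> defined on points extends linearly to formal combinations of points. The
  extension respects the norm of the Lipschitz-free space by duality: if \<open>f\<close> is a functional of
  norm at most 1 that norms the image of a combination, then \<open>f\<close> composed with \<open>g\<close> is a
  Lipschitz function vanishing at 0, so the combination of point evaluations can be tested
  against it.
\<close>

lemma lip_free_universal:
  fixes g :: "'a::real_normed_vector \<Rightarrow> 'g::banach"
  assumes g: "C-lipschitz_on UNIV g" and g0: "g 0 = 0"
  shows "\<exists>T :: 'a lip_free \<Rightarrow>\<^sub>L 'g. norm T \<le> C \<and> (\<forall>x. blinfun_apply T (delta x) = g x)"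
proof -
  obtain j :: "('a \<Rightarrow>\<^sub>0 real) \<Rightarrow> 'a lip_free"
    where j: "linear j" and j_single: "\<And>x. j (Poly_Mapping.single x 1) = delta x"
    using ex_linear_poly_mapping[of delta] by blast
  obtain L :: "('a \<Rightarrow>\<^sub>0 real) \<Rightarrow> 'g"
    where L: "linear L" and L_single: "\<And>x. L (Poly_Mapping.single x 1) = g x"
    using ex_linear_poly_mapping[of g] by blast
  have C: "0 \<le> C" using g by (rule lipschitz_on_nonneg)
  have bound: "norm (L v) \<le> C * norm (j v)" for v
  proof -
    obtain f :: "'g \<Rightarrow>\<^sub>L real" where f: "norm f \<le> 1" "blinfun_apply f (L v) = norm (L v)"
      using ex_norming_functional by blast
    have lip: "C-lipschitz_on UNIV (\<lambda>x. blinfun_apply f (g x))"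
    proof (rule lipschitz_onI[OF _ C])
      fix x y
      have "dist (blinfun_apply f (g x)) (blinfun_apply f (g y)) \<le> norm f * dist (g x) (g y)"
        using norm_blinfun[of f "g x - g y"] by (simp add: dist_norm blinfun.diff_right)
      also have "\<dots> \<le> 1 * dist (g x) (g y)" using f(1) by (intro mult_right_mono) auto
      also have "\<dots> \<le> C * dist x y" using lipschitz_onD[OF g, of x y] by simp
      finally show "dist (blinfun_apply f (g x)) (blinfun_apply f (g y)) \<le> C * dist x y" .
    qed
    define F where "F = Lip0 (\<lambda>x. blinfun_apply f (g x))"
    have F: "lip0_apply F = (\<lambda>x. blinfun_apply f (g x))"
      unfolding F_def using lip g0 by (intro Lip0_inverse) auto
    have pairing: "blinfun_apply f (L w) = blinfun_apply (Rep_lip_free (j w)) F" for w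
    proof (induction w rule: update_induct)
      case const
      show ?case
        by (simp add: linear_0[OF L] linear_0[OF j] zero_lip_free.rep_eq)
    next
      case (update w a b)
      have "Poly_Mapping.update a b w = b *\<^sub>R Poly_Mapping.single a 1 + w"
        using update(1) by (intro poly_mapping_eqI)
          (auto simp: lookup_add lookup_single scaleR_poly_mapping.rep_eq lookup_update in_keys_iff when_def)
      then show ?case
        using update(3)
        by (simp add: linear_add[OF L] linear_scale[OF L] linear_add[OF j] linear_scale[OF j]
            L_single j_single plus_lip_free.rep_eq scaleR_lip_free.rep_eq plus_blinfun.rep_eq
            scaleR_blinfun.rep_eq blinfun.add_right blinfun.scaleR_right lip_free_apply_delta F)
    qed
    have "norm (L v) = norm (blinfun_apply (Rep_lip_free (j v)) F)"
      using pairing[of v] f(2) norm_ge_zero[of "L v"] by (simp del: norm_ge_zero)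
    also have "\<dots> \<le> norm (j v) * norm F"
      unfolding norm_lip_free.rep_eq by (rule norm_blinfun)
    also have "\<dots> \<le> norm (j v) * C"
      using lip by (intro mult_left_mono norm_lip0_le) (auto simp: F)
    finally show ?thesis by (simp add: mult.commute)
  qed
  have "span (range delta) \<subseteq> range j"
  proof (rule span_minimal)
    show "range delta \<subseteq> range j" by (auto simp: j_single[symmetric])
    show "subspace (range j)" by (intro linear_subspace_image j subspace_UNIV)
  qed
  then have "closure (range j) = UNIV"
    using closure_mono[of "span (range delta)" "range j"] dense_span_delta by auto
  from ex_blinfun_extension[OF j L bound C this] obtain T :: "'a lip_free \<Rightarrow>\<^sub>L 'g"
    where T: "norm T \<le> C" "\<And>v. blinfun_apply T (j v) = L v" by blast
  show ?thesis
    using T(1) T(2)[of "Poly_Mapping.single _ 1"] by (intro exI[of _ T]) (simp add: j_single L_single)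
qed

text \<open>
  The barycentre is the extension of the identity, which is 1-Lipschitz.
\<close>

lemma barycentre_props:
  shows barycentre_delta: "blinfun_apply barycentre (delta x) = (x :: 'a::banach)"
    and norm_barycentre_le: "norm (barycentre :: 'a lip_free \<Rightarrow>\<^sub>L 'a) \<le> 1"
proof -
  have "1-lipschitz_on UNIV (\<lambda>x :: 'a. x)" by (rule lipschitz_onI) auto
  from lip_free_universal[OF this] obtain T :: "'a lip_free \<Rightarrow>\<^sub>L 'a"
    where T: "norm T \<le> 1" "\<And>x. blinfun_apply T (delta x) = x" by auto
  have "barycentre = T"
    unfolding barycentre_def
    by (rule the_blinfun_eqI[OF dense_span_delta, where g = "blinfun_apply T"]) (auto simp: T)
  then show "blinfun_apply barycentre (delta x) = x"
    and "norm (barycentre :: 'a lip_free \<Rightarrow>\<^sub>L 'a) \<le> 1" using T by auto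
qed

lemma lip_free_shift_delta:
  "blinfun_apply (lip_free_shift a) (delta x) = delta (x + a) - delta (a :: 'a::real_normed_vector)"
proof -
  have "1-lipschitz_on UNIV (\<lambda>x. delta (x + a) - delta a)"
  proof (rule lipschitz_onI)
    fix x y :: 'a
    show "dist (delta (x + a) - delta a) (delta (y + a) - delta a) \<le> 1 * dist x y"
      using norm_delta_diff_le[of "x + a" "y + a"] by (simp add: dist_norm)
  qed simp
  from lip_free_universal[OF this] obtain T :: "'a lip_free \<Rightarrow>\<^sub>L 'a lip_free"
    where T: "\<And>x. blinfun_apply T (delta x) = delta (x + a) - delta a" by auto
  have "lip_free_shift a = T"
    unfolding lip_free_shift_def
    by (rule the_blinfun_eqI[OF dense_span_delta, where g = "blinfun_apply T"]) (auto simp: T)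
  then show ?thesis using T by simp
qed


section \<open>The universal property of the projective tensor product\<close>

text \<open>
  The projective norm is the largest norm satisfying \<open>norm (tensor_elem x y) \<le> norm x * norm y\<close>,
  so a bound for \<open>L\<close> on elementary tensors passes, with the same constant, to every representation
  of \<open>u\<close> and hence to the infimum over them.
\<close>

lemma norm_linear_tensor_le:
  fixes L :: "('a::real_normed_vector, 'b::real_normed_vector) tensor \<Rightarrow> 'c::real_normed_vector"
  assumes L: "linear L" and K: "0 \<le> K"
    and elem: "\<And>x y. norm (L (tensor_elem x y)) \<le> K * (norm x * norm y)"
  shows "norm (L u) \<le> K * norm u"
proof -
  have sum: "norm (L (\<Sum>(x, y)\<leftarrow>xs. tensor_elem x y)) \<le> K * (\<Sum>(x, y)\<leftarrow>xs. norm x * norm y)" for xs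
  proof (induction xs)
    case (Cons p xs)
    obtain x y where p: "p = (x, y)" by (cases p)
    show ?case
      using Cons elem[of x y] norm_triangle_ineq[of "L (tensor_elem x y)" "L (\<Sum>(x, y)\<leftarrow>xs. tensor_elem x y)"]
      by (simp add: p linear_add[OF L] distrib_left)
  qed (simp add: linear_0[OF L])
  show ?thesis
  proof (cases "K = 0")
    case True
    obtain xs where "u = (\<Sum>(x, y)\<leftarrow>xs. tensor_elem x y)" using tensor_eq_sum_list by blast
    then show ?thesis using sum[of xs] True by simp
  next
    case False
    have "norm (L u) / K \<le> norm u"
      unfolding norm_tensor_def
      by (rule projective_norm_ge) (use sum False K in \<open>auto simp: field_simps\<close>)
    then show ?thesis using False K by (simp add: field_simps)
  qed
qed

lemma norm_ptensor_elem_le: "norm (x \<otimes> y) \<le> norm x * norm y"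
  using projective_norm_le[of "[(x, y)]"]
  by (simp add: ptensor_elem_def norm_to_completion norm_tensor_def)

lemma norm_delta_ptensor_le: "norm (delta x \<otimes> delta y) \<le> norm x * norm y"
  by (rule order_trans[OF norm_ptensor_elem_le]) (intro mult_mono norm_delta_le; simp)

lemma bounded_bilinear_ptensor_elem:
  "bounded_bilinear (ptensor_elem :: 'a::real_normed_vector \<Rightarrow> 'b::real_normed_vector \<Rightarrow> _)"
proof
  note lin = linear_to_completion and bil = bilinear_tensor_elem
  show "(x + x') \<otimes> y = x \<otimes> y + x' \<otimes> y" for x x' :: 'a and y :: 'b
    by (simp add: ptensor_elem_def bilinear_ladd[OF bil] linear_add[OF lin])
  show "x \<otimes> (y + y') = x \<otimes> y + x \<otimes> y'" for x :: 'a and y y' :: 'b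
    by (simp add: ptensor_elem_def bilinear_radd[OF bil] linear_add[OF lin])
  show "(r *\<^sub>R x) \<otimes> y = r *\<^sub>R (x \<otimes> y)" for r and x :: 'a and y :: 'b
    by (simp add: ptensor_elem_def bilinear_lmul[OF bil] linear_scale[OF lin])
  show "x \<otimes> (r *\<^sub>R y) = r *\<^sub>R (x \<otimes> y)" for r and x :: 'a and y :: 'b
    by (simp add: ptensor_elem_def bilinear_rmul[OF bil] linear_scale[OF lin])
  show "\<exists>K. \<forall>(x::'a) (y::'b). norm (x \<otimes> y) \<le> norm x * norm y * K"
    by (intro exI[of _ 1]) (simp add: norm_ptensor_elem_le)
qed

interpretation ptensor: bounded_bilinear ptensor_elem
  by (rule bounded_bilinear_ptensor_elem)

lemma to_completion_sum_list:
  "to_completion (\<Sum>(x, y)\<leftarrow>xs. tensor_elem x y) = (\<Sum>(x, y)\<leftarrow>xs. x \<otimes> y)"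
  by (induction xs)
    (auto simp: linear_0[OF linear_to_completion] linear_add[OF linear_to_completion] ptensor_elem_def)

lemma dense_span_ptensor_elem:
  "closure (span (range (\<lambda>(x, y). x \<otimes> y))) =
    (UNIV :: ('a::real_normed_vector, 'b::real_normed_vector) projective_tensor set)"
proof -
  have "to_completion t \<in> span (range (\<lambda>(x, y). x \<otimes> y))" for t :: "('a, 'b) tensor"
  proof -
    obtain xs where t: "t = (\<Sum>(x, y)\<leftarrow>xs. tensor_elem x y)" using tensor_eq_sum_list by blast
    show ?thesis
      unfolding t to_completion_sum_list
      by (induction xs) (auto intro: span_zero span_add span_base)
  qed
  then have "range to_completion \<subseteq> span (range (\<lambda>(x :: 'a, y :: 'b). x \<otimes> y))" by blast
  from closure_mono[OF this] show ?thesis using dense_range_to_completion by blast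
qed

text \<open>
  Density of the point evaluations is used in one factor at a time: the \<open>u\<close> with \<open>u \<otimes> delta y\<close>
  in the closed span form a closed subspace containing every \<open>delta x\<close>, and then so do the \<open>v\<close>
  with \<open>u \<otimes> v\<close> in it.
\<close>

lemma dense_span_delta_ptensor:
  "closure (span (range (\<lambda>(x, y). delta x \<otimes> delta y))) =
    (UNIV :: ('a::real_normed_vector, 'b::real_normed_vector) free_tensor set)"
proof -
  let ?M = "closure (span (range (\<lambda>(x :: 'a, y :: 'b). delta x \<otimes> delta y)))"
  have sub: "subspace ?M" by (intro subspace_closure subspace_span)
  have left: "u \<otimes> delta y \<in> ?M" for u :: "'a lip_free" and y :: 'b
  proof -
    have "{u. u \<otimes> delta y \<in> ?M} = UNIV"
    proof (rule dense_span_subset[OF dense_span_delta])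
      show "subspace {u. u \<otimes> delta y \<in> ?M}"
        using linear_subspace_vimage[OF bounded_linear.linear[OF ptensor.bounded_linear_left] sub]
        by (simp add: vimage_def)
      show "closed {u. u \<otimes> delta y \<in> ?M}"
        using closed_vimage[OF closed_closure, of "\<lambda>u. u \<otimes> delta y"]
        by (simp add: vimage_def ptensor.continuous_on continuous_intros)
    qed (auto intro!: closure_subset[THEN subsetD] span_base)
    then show ?thesis by blast
  qed
  have both: "u \<otimes> v \<in> ?M" for u :: "'a lip_free" and v :: "'b lip_free"
  proof -
    have "{v. u \<otimes> v \<in> ?M} = UNIV"
    proof (rule dense_span_subset[OF dense_span_delta])
      show "subspace {v. u \<otimes> v \<in> ?M}"
        using linear_subspace_vimage[OF bounded_linear.linear[OF ptensor.bounded_linear_right] sub]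
        by (simp add: vimage_def)
      show "closed {v. u \<otimes> v \<in> ?M}"
        using closed_vimage[OF closed_closure, of "\<lambda>v. u \<otimes> v"]
        by (simp add: vimage_def ptensor.continuous_on continuous_intros)
    qed (use left in auto)
    then show ?thesis by blast
  qed
  show ?thesis
    by (rule dense_span_subset[OF dense_span_ptensor_elem sub closed_closure]) (use both in auto)
qed

lemma ptensor_map_props:
  fixes A :: "'a::real_normed_vector \<Rightarrow>\<^sub>L 'c::real_normed_vector"
    and B :: "'b::real_normed_vector \<Rightarrow>\<^sub>L 'd::real_normed_vector"
  shows ptensor_map_elem:
      "blinfun_apply (ptensor_map A B) (u \<otimes> v) = blinfun_apply A u \<otimes> blinfun_apply B v"
    and norm_ptensor_map_le: "norm (ptensor_map A B) \<le> norm A * norm B"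
proof -
  have "bilinear (\<lambda>u v. blinfun_apply A u \<otimes> blinfun_apply B v)"
    unfolding bilinear_def
    by (auto intro!: linearI simp: blinfun.add_right blinfun.scaleR_right ptensor.add_left
        ptensor.add_right ptensor.scaleR_left ptensor.scaleR_right)
  from tensor_universal[OF this] obtain L :: "('a, 'b) tensor \<Rightarrow> ('c, 'd) projective_tensor"
    where L: "linear L"
      and L_elem: "\<And>u v. L (tensor_elem u v) = blinfun_apply A u \<otimes> blinfun_apply B v" by blast
  have "norm (L (tensor_elem u v)) \<le> (norm A * norm B) * (norm u * norm v)" for u v
  proof -
    have "norm (L (tensor_elem u v)) \<le> norm (blinfun_apply A u) * norm (blinfun_apply B v)"
      unfolding L_elem by (rule norm_ptensor_elem_le)
    also have "\<dots> \<le> (norm A * norm u) * (norm B * norm v)"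
      by (intro mult_mono norm_blinfun) auto
    finally show ?thesis by (simp add: mult_ac)
  qed
  then have "norm (L t) \<le> (norm A * norm B) * norm (to_completion t)" for t
    unfolding norm_to_completion by (intro norm_linear_tensor_le[OF L]) auto
  from ex_blinfun_extension[OF linear_to_completion L this _ dense_range_to_completion]
  obtain T :: "('a, 'b) projective_tensor \<Rightarrow>\<^sub>L ('c, 'd) projective_tensor"
    where T: "norm T \<le> norm A * norm B" "\<And>t. blinfun_apply T (to_completion t) = L t" by auto
  have T_elem: "blinfun_apply T (u \<otimes> v) = blinfun_apply A u \<otimes> blinfun_apply B v" for u v
    using T(2)[of "tensor_elem u v"] by (simp add: L_elem ptensor_elem_def)
  have "ptensor_map A B = T"
    unfolding ptensor_map_def
    by (rule the_blinfun_eqI[OF dense_span_ptensor_elem, where g = "blinfun_apply T"])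
      (auto simp: T_elem)
  then show "blinfun_apply (ptensor_map A B) (u \<otimes> v) = blinfun_apply A u \<otimes> blinfun_apply B v"
    and "norm (ptensor_map A B) \<le> norm A * norm B" using T(1) T_elem by auto
qed


section \<open>The kernel and the quotient norm\<close>

lemma Q_op_elem: "blinfun_apply Q_op (delta x \<otimes> delta y) = x \<otimes> y"
  by (simp add: Q_op_def ptensor_map_elem barycentre_delta)

lemma norm_Q_op_apply_le: "norm (blinfun_apply Q_op u) \<le> norm u"
proof -
  have "norm (Q_op :: ('a, 'b) free_tensor \<Rightarrow>\<^sub>L ('a, 'b) projective_tensor)
      \<le> norm (barycentre :: 'a lip_free \<Rightarrow>\<^sub>L 'a) * norm (barycentre :: 'b lip_free \<Rightarrow>\<^sub>L 'b)"
    unfolding Q_op_def by (rule norm_ptensor_map_le)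
  also have "\<dots> \<le> 1 * 1" by (intro mult_mono norm_barycentre_le) auto
  finally show ?thesis
    using norm_blinfun[of Q_op u] mult_right_mono[of "norm (Q_op :: ('a, 'b) free_tensor \<Rightarrow>\<^sub>L _)" 1 "norm u"]
    by simp
qed

lemma shift_op_elem:
  "blinfun_apply (shift_op a b) (delta x \<otimes> delta y) =
    (delta (x + a) - delta a) \<otimes> (delta (y + b) - delta b)"
  by (simp add: shift_op_def ptensor_map_elem lip_free_shift_delta)

lemma Q_op_shift_op: "blinfun_apply Q_op (blinfun_apply (shift_op a b) u) = blinfun_apply Q_op u"
proof -
  have "Q_op o\<^sub>L shift_op a b = Q_op"
    by (rule blinfun_eq_if_eq_on_dense[OF dense_span_delta_ptensor])
      (auto simp: shift_op_elem Q_op_elem Q_op_def ptensor_map_elem barycentre_delta blinfun.diff_right)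
  then show ?thesis by (metis blinfun_apply_blinfun_compose)
qed

lemma Q_op_eq_0_if_Z_space:
  assumes "u \<in> Z_space"
  shows "blinfun_apply Q_op u = 0"
proof -
  let ?K = "{u. blinfun_apply Q_op u \<in> {0}}"
  have "Z_space \<subseteq> ?K"
    unfolding Z_space_def
  proof (intro closure_minimal span_minimal)
    show "closed ?K" by (simp, intro closed_Collect_eq continuous_intros)
    show "subspace ?K" by (rule subspace_vimage_blinfun) (rule subspace_single_0)
  qed (auto simp: blinfun.diff_right Q_op_shift_op)
  then show ?thesis using assms by auto
qed

lemma norm_Z_coset_le: "norm (Z_coset u) \<le> norm u"
  unfolding norm_Z_quotient_def by (rule quotient_norm_le)

lemma bounded_linear_Z_coset: "bounded_linear Z_coset"
  using norm_Z_coset_le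
  by (intro bounded_linear_intro[where K = 1])
    (auto simp: linear_add[OF linear_Z_coset] linear_scale[OF linear_Z_coset])

lemma Z_coset_shift_op: "Z_coset (blinfun_apply (shift_op a b) u) = Z_coset u"
  unfolding Z_coset_eq_iff Z_space_def
  by (intro closure_subset[THEN subsetD] span_base) blast

text \<open>
  Additivity in one variable comes from shifting that factor alone: as \<open>delta 0 = 0\<close>, the shift by
  \<open>(0, y')\<close> maps \<open>delta x \<otimes> delta y\<close> to \<open>delta x \<otimes> (delta (y + y') - delta y')\<close>, which lies in
  the same coset.
\<close>

lemma bilinear_Z_coset_delta:
  "bilinear (\<lambda>(x :: 'a::real_normed_vector) (y :: 'b::real_normed_vector). Z_coset (delta x \<otimes> delta y))"
proof -
  let ?B = "\<lambda>(x :: 'a) (y :: 'b). Z_coset (delta x \<otimes> delta y)"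
  have bound: "norm (?B x y) \<le> norm x * norm y" for x y
    using norm_Z_coset_le norm_delta_ptensor_le by (rule order_trans)
  have "linear (\<lambda>y. ?B x y)" for x
  proof (rule linear_if_additive_bounded)
    show "?B x (y + y') = ?B x y + ?B x y'" for y y'
      using Z_coset_shift_op[of 0 y' "delta x \<otimes> delta y"]
      by (simp add: shift_op_elem ptensor.diff_right linear_diff[OF linear_Z_coset] diff_eq_eq)
  qed (rule bound)
  moreover have "linear (\<lambda>x. ?B x y)" for y
  proof (rule linear_if_additive_bounded)
    show "?B (x + x') y = ?B x y + ?B x' y" for x x'
      using Z_coset_shift_op[of x' 0 "delta x \<otimes> delta y"]
      by (simp add: shift_op_elem ptensor.diff_left linear_diff[OF linear_Z_coset] diff_eq_eq)
    show "norm (?B x y) \<le> norm y * norm x" for x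
      using bound[of x y] by (simp add: mult.commute)
  qed
  ultimately show ?thesis by (simp add: bilinear_def)
qed

text \<open>
  On the linear span of the tensors \<open>delta x \<otimes> delta y\<close>, \<open>Z_coset\<close> factors through \<open>Q_op\<close> as a
  contraction of the algebraic tensor product of \<open>X\<close> and \<open>Y\<close>. The inequality is a closed
  condition and the span is dense.
\<close>

lemma norm_Z_coset_le_norm_Q_op:
  fixes u :: "('a::banach, 'b::banach) free_tensor"
  shows "norm (Z_coset u) \<le> norm (blinfun_apply Q_op u)"
proof -
  obtain T :: "('a, 'b) tensor \<Rightarrow> ('a, 'b) Z_quotient" where T: "linear T"
    and T_elem: "\<And>x y. T (tensor_elem x y) = Z_coset (delta x \<otimes> delta y)"
    using tensor_universal[OF bilinear_Z_coset_delta] by blast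
  have "norm (T (tensor_elem x y)) \<le> 1 * (norm x * norm y)" for x y
    unfolding T_elem using order_trans[OF norm_Z_coset_le norm_delta_ptensor_le] by simp
  then have T_bound: "norm (T t) \<le> norm t" for t
    using norm_linear_tensor_le[OF T, of 1 t] by simp
  let ?W = "span (range (\<lambda>(x :: 'a, y :: 'b). delta x \<otimes> delta y))"
  have "\<exists>t. blinfun_apply Q_op w = to_completion t \<and> Z_coset w = T t" if "w \<in> ?W" for w
    using that
  proof (rule span_induct)
    show "subspace {w. \<exists>t. blinfun_apply Q_op w = to_completion t \<and> Z_coset w = T t}"
      unfolding subspace_def
      by (auto simp: linear_0[OF linear_Z_coset] linear_add[OF linear_Z_coset]
          linear_scale[OF linear_Z_coset] blinfun.add_right blinfun.scaleR_right)
        (metis T linear_to_completion linear_0 linear_add linear_scale)+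
  qed (auto simp: Q_op_elem ptensor_elem_def[of "_ :: 'a" "_ :: 'b"] T_elem[symmetric])
  then have "norm (Z_coset w) \<le> norm (blinfun_apply Q_op w)" if "w \<in> ?W" for w
    using that T_bound by (metis norm_to_completion)
  then have "closure ?W \<subseteq> {u. norm (Z_coset u) \<le> norm (blinfun_apply Q_op u)}"
    by (intro closure_minimal closed_Collect_le continuous_intros
        bounded_linear.continuous_on[OF bounded_linear_Z_coset]) auto
  then show ?thesis unfolding dense_span_delta_ptensor by blast
qed

lemma Z_space_eq_kernel: "(Z_space :: ('a::banach, 'b::banach) free_tensor set) = {u. blinfun_apply Q_op u = 0}"
proof (intro set_eqI iffI CollectI)
  fix u :: "('a, 'b) free_tensor"
  assume "u \<in> {u. blinfun_apply Q_op u = 0}"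
  then have "Z_coset u = Z_coset 0"
    using norm_Z_coset_le_norm_Q_op[of u] by (simp add: linear_0[OF linear_Z_coset])
  then show "u \<in> Z_space" by (simp add: Z_coset_eq_iff)
qed (rule Q_op_eq_0_if_Z_space)

text \<open>
  A nearly optimal representation of a tensor over \<open>X\<close> and \<open>Y\<close> lifts by replacing every point
  with its evaluation functional, whose norm is no larger. The factor 2 leaves room because the
  infimum in the projective norm need not be attained.
\<close>

lemma surj_Q_op: "surj (blinfun_apply (Q_op :: ('a::banach, 'b::banach) free_tensor \<Rightarrow>\<^sub>L _))"
proof (rule surj_if_bounded_lift_on_dense[where K = 2, OF _ dense_range_to_completion])
  show "subspace (range (to_completion :: ('a, 'b) tensor \<Rightarrow> _))"
    by (intro linear_subspace_image linear_to_completion subspace_UNIV)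
  fix s :: "('a, 'b) projective_tensor" assume "s \<in> range to_completion"
  then obtain t where s: "s = to_completion t" by blast
  show "\<exists>v. blinfun_apply Q_op v = s \<and> norm v \<le> 2 * norm s"
  proof (cases "t = 0")
    case True
    then show ?thesis by (intro exI[of _ 0]) (simp add: s linear_0[OF linear_to_completion])
  next
    case False
    then have "\<not> 2 * norm t \<le> projective_norm t" by (simp add: norm_tensor_def[symmetric])
    then obtain xs where t: "t = (\<Sum>(x, y)\<leftarrow>xs. tensor_elem x y)"
      and cost: "(\<Sum>(x, y)\<leftarrow>xs. norm x * norm y) < 2 * norm t"
      using projective_norm_ge[of t "2 * norm t"] by (meson not_le)
    let ?v = "\<Sum>(x, y)\<leftarrow>xs. delta x \<otimes> delta y"
    have "blinfun_apply Q_op ?v = s"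
      unfolding s t to_completion_sum_list by (induction xs) (auto simp: blinfun.add_right Q_op_elem)
    moreover have "norm ?v \<le> (\<Sum>(x, y)\<leftarrow>xs. norm x * norm y)"
    proof (induction xs)
      case (Cons p xs)
      obtain x y where p: "p = (x, y)" by (cases p)
      show ?case
        using Cons norm_delta_ptensor_le[of x y]
          norm_triangle_ineq[of "delta x \<otimes> delta y" "\<Sum>(x, y)\<leftarrow>xs. delta x \<otimes> delta y"]
        by (simp add: p)
    qed simp
    ultimately show ?thesis using cost by (intro exI[of _ ?v]) (simp add: s norm_to_completion)
  qed
qed

theorem theorem4p14:
  shows "(Z_space :: ('a::banach, 'b::banach) free_tensor set) = {u. blinfun_apply Q_op u = 0} \<and>
    (\<exists>Qt :: ('a, 'b) Z_quotient \<Rightarrow>\<^sub>L ('a, 'b) projective_tensor.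
       (\<forall>u. blinfun_apply Qt (Z_coset u) = blinfun_apply Q_op u) \<and>
       surj (blinfun_apply Qt) \<and>
       (\<forall>w. norm (blinfun_apply Qt w) = norm w) \<and>
       (\<forall>x y. blinfun_apply Qt (Z_coset (delta x \<otimes> delta y)) = x \<otimes> y) \<and>
       (\<forall>T :: ('a, 'b) Z_quotient \<Rightarrow>\<^sub>L ('a, 'b) projective_tensor.
          (\<forall>x y. blinfun_apply T (Z_coset (delta x \<otimes> delta y)) = x \<otimes> y) \<longrightarrow> T = Qt))"
proof (intro conjI Z_space_eq_kernel)
  \<comment> \<open>The choice of representatives \<open>r\<close> does not matter, as \<open>Q_op\<close> vanishes on \<open>Z_space\<close>.\<close>
  obtain r :: "('a, 'b) Z_quotient \<Rightarrow> ('a, 'b) free_tensor" where r: "\<And>w. Z_coset (r w) = w"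
    using Z_coset_surj by metis
  define q where "q = (\<lambda>w. blinfun_apply Q_op (r w))"
  have q_coset: "q (Z_coset u) = blinfun_apply Q_op u" for u
  proof -
    have "r (Z_coset u) - u \<in> Z_space" by (simp add: Z_coset_eq_iff[symmetric] r)
    from Q_op_eq_0_if_Z_space[OF this] show ?thesis by (simp add: q_def blinfun.diff_right)
  qed
  have q_norm: "norm (q w) = norm w" for w
  proof (rule antisym)
    show "norm (q w) \<le> norm w"
      unfolding norm_Z_quotient_def
      by (rule quotient_norm_ge) (auto simp: q_coset norm_Q_op_apply_le)
    show "norm w \<le> norm (q w)"
      using norm_Z_coset_le_norm_Q_op[of "r w"] by (simp add: r q_def)
  qed
  have "bounded_linear q"
  proof (rule bounded_linear_intro[where K = 1])
    show "q (v + w) = q v + q w" for v w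
      using q_coset[of "r v + r w"] by (simp add: linear_add[OF linear_Z_coset] r blinfun.add_right q_def)
    show "q (c *\<^sub>R w) = c *\<^sub>R q w" for c w
      using q_coset[of "c *\<^sub>R r w"] by (simp add: linear_scale[OF linear_Z_coset] r blinfun.scaleR_right q_def)
  qed (simp add: q_norm)
  then have app: "blinfun_apply (Blinfun q) = q" by (rule bounded_linear_Blinfun_apply)
  show "\<exists>Qt :: ('a, 'b) Z_quotient \<Rightarrow>\<^sub>L ('a, 'b) projective_tensor.
       (\<forall>u. blinfun_apply Qt (Z_coset u) = blinfun_apply Q_op u) \<and>
       surj (blinfun_apply Qt) \<and>
       (\<forall>w. norm (blinfun_apply Qt w) = norm w) \<and>
       (\<forall>x y. blinfun_apply Qt (Z_coset (delta x \<otimes> delta y)) = x \<otimes> y) \<and>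
       (\<forall>T :: ('a, 'b) Z_quotient \<Rightarrow>\<^sub>L ('a, 'b) projective_tensor.
          (\<forall>x y. blinfun_apply T (Z_coset (delta x \<otimes> delta y)) = x \<otimes> y) \<longrightarrow> T = Qt)"
  proof (intro exI[of _ "Blinfun q"] conjI allI impI)
    show "surj (blinfun_apply (Blinfun q))"
      using surj_Q_op unfolding app surj_def by (metis q_coset)
    fix T :: "('a, 'b) Z_quotient \<Rightarrow>\<^sub>L ('a, 'b) projective_tensor"
    assume T: "\<forall>x y. blinfun_apply T (Z_coset (delta x \<otimes> delta y)) = x \<otimes> y"
    have "T o\<^sub>L Blinfun Z_coset = Q_op"
      by (rule blinfun_eq_if_eq_on_dense[OF dense_span_delta_ptensor])
        (auto simp: bounded_linear_Blinfun_apply[OF bounded_linear_Z_coset] T Q_op_elem)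
    then have "blinfun_apply T (Z_coset u) = q (Z_coset u)" for u
      by (metis blinfun_apply_blinfun_compose bounded_linear_Blinfun_apply bounded_linear_Z_coset q_coset)
    then show "T = Blinfun q"
      by (intro blinfun_eqI) (metis app r)
  qed (simp_all add: app q_coset q_norm Q_op_elem)
qed

end
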